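(* Fix $q\in\mathbb R$. Assume that $\beta(q)\notin\{-dq,1-dq,\dots,d-dq\}$. (1) (Non-arithmetic case) If the set $\{\log r_1^{-1},\dots,\log r_N^{-1}\}$ is not contained in a discrete additive subgroup of $\mathbb R$, then $$\frac1{r^{-\beta(q)}}V_{\mu,r}^{q,\mathrm{sym}}(K)=c_q^{\mathrm{sym}}+\varepsilon_q^{\mathrm{sym}}(r)$$ for all $0<r<r_{\min}$, where $c_q^{\mathrm{sym}}\in\mathbb R$ is the constant $$c_q^{\mathrm{sym}}=-\frac1{\sum_ip_i^qr_i^{\beta(q)}\log r_i}\sum_{l=0}^d\frac{\kappa_\mu^{q,l}(K)(\sigma_{q,l}-1)}{\beta(q)-(l-dq)}$$ and $\varepsilon_q^{\mathrm{sym}}(r)\to0$ as $r\searrow0$. In addition, $K$ is $(q,\beta(q))$ symbolic multifractal Minkowski measurable with respect to $\mu$ with $$M_\mu^{q,\beta(q),\mathrm{sym}}(K)=-\frac1{\sum_ip_i^qr_i^{\beta(q)}\log r_i}\sum_{l=0}^d\frac{\kappa_\mu^{q,l}(K)(\sigma_{q,l}-1)}{\beta(q)-(l-dq)}.$$ (2) (Arithmetic case) If the set $\{\log r_1^{-1},\dots,\log r_N^{-1}\}$ is contained in a discrete additive subgroup of $\mathbb R$ and the subgroup generated by it is $\langle\log r_1^{-1},\dots,\log r_N^{-1}\rangle=u\mathbb Z$ with $u>0$, then $$\frac1{r^{-\beta(q)}}V_{\mu,r}^{q,\mathrm{sym}}(K)=\pi_q^{\mathrm{sym}}(r)+\varepsilon_q^{\mathrm{sym}}(r)$$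 for all $0<r<r_{\min}$, where $\pi_q^{\mathrm{sym}}:(0,\infty)\to\mathbb R$ is the multiplicatively periodic function with period $e^u$ (i.e. $\pi_q^{\mathrm{sym}}(e^ur)=\pi_q^{\mathrm{sym}}(r)$ for all $r\in(0,\infty)$) given by $$\pi_q^{\mathrm{sym}}(r)=-\frac1{\sum_ip_i^qr_i^{\beta(q)}\log r_i}\;u\sum_{l=0}^d\frac{\kappa_\mu^{q,l}(K)(\sigma_{q,l}-1)}{1-e^{-u(\beta(q)-(l-dq))}}\;\theta_l(r),$$ $$\theta_l(r)=\begin{cases}\dfrac{e^{-u(\beta(q)-(l-dq))}+1}2&\text{for }r\in e^{\mathbb Zu},\\[2mm] e^{-u(\beta(q)-(l-dq))\,\mathrm{frac}(-\frac{\log r}u)}&\text{for }r\notin e^{\mathbb Zu},\end{cases}$$ and $\varepsilon_q^{\mathrm{sym}}(r)\to0$ as $r\searrow0$. In addition, $K$ is $(q,\beta(q))$ average symbolic multifractal Minkowski measurable with respect to $\mu$ with $$M_{\mu,\mathrm{ave}}^{q,\beta(q),\mathrm{sym}}(K)=-\frac1{\sum_ip_i^qr_i^{\beta(q)}\log r_i}\sum_{l=0}^d\frac{\kappa_\mu^{q,l}(K)(\sigma_{q,l}-1)}{\beta(q)-(l-dq)}.$$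
   Context: Let $d\ge1$ and $N\ge2$ be integers, $S_1,\dots,S_N:\mathbb R^d\to\mathbb R^d$ contracting similarities with ratios $r_1,\dots,r_N\in(0,1)$, and $(p_1,\dots,p_N)$ a probability vector with all $p_i>0$. $K$ is the self-similar set ($K$ non-empty compact, $K=\bigcup_iS_i(K)$) and $\mu$ the self-similar measure ($\mu=\sum_ip_i\mu\circ S_i^{-1}$, a Borel probability measure). For $q\in\mathbb R$, $\beta(q)$ is the unique real number with $\sum_ip_i^qr_i^{\beta(q)}=1$. $r_{\min}=\min_ir_i$. $\mathrm{frac}(x)$ is the fractional part of $x\in\mathbb R$, and $e^{\mathbb Zu}=\{e^{nu}:n\in\mathbb Z\}$. $\Sigma^*$ is the set of all finite non-empty strings $\mathbf i=i_1\dots i_m$ over $\{1,\dots,N\}$; $r_{\mathbf i}=r_{i_1}\cdots r_{i_m}$, $p_{\mathbf i}=p_{i_1}\cdots p_{i_m}$, and $\hat{\mathbf i}=i_1\dots i_{m-1}$ is the parent of $\mathbf i$ (for the empty string $r_\varnothing=1$). For $l=0,1,\dots,d$ put $\sigma_{q,l}=\sum_{i=1}^Np_i^qr_i^{l-dq}$ and $$C_{\mu,r}^{q,l,\mathrm{sym}}(K)=\sum_{\mathbf i\in\Sigma^*,\ r_{\mathbf i}<r<r_{\hat{\mathbf i}}}p_{\mathbf i}^qr_{\mathbf i}^{l-dq}+\frac{1+\frac1{\sigma_{q,l}}}2\sum_{\mathbf i\in\Sigma^*,\ r=r_{\hat{\mathbf i}}}p_{\mathbf i}^qr_{\mathbf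 i}^{l-dq}.$$ Let $\kappa_\mu^{q,0}(K),\dots,\kappa_\mu^{q,d}(K)$ be arbitrary real numbers satisfying the consistency condition $\sum_{l=0}^d\kappa_\mu^{q,l}(K)(\sigma_{q,l}-1)=0$. The symbolic $q$ multifractal Minkowski volume is $$V_{\mu,r}^{q,\mathrm{sym}}(K)=\sum_{l=0}^d\kappa_\mu^{q,l}(K)\,C_{\mu,r}^{q,l,\mathrm{sym}}(K)\,r^{-l+dq}.$$ For $q,t\in\mathbb R$, $K$ is $(q,t)$ symbolic multifractal Minkowski measurable with respect to $\mu$ if the limit $M_\mu^{q,t,\mathrm{sym}}(K)=\lim_{r\searrow0}\frac1{r^{-t}}V_{\mu,r}^{q,\mathrm{sym}}(K)$ exists, and $(q,t)$ average symbolic multifractal Minkowski measurable if the limit $M_{\mu,\mathrm{ave}}^{q,t,\mathrm{sym}}(K)=\lim_{r\searrow0}\frac1{-\log r}\int_r^1\frac1{s^{-t}}V_{\mu,s}^{q,\mathrm{sym}}(K)\frac{ds}s$ exists. *)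

theory Defs
  imports
    "HOL-Analysis.Analysis"
    "HOL-Probability.Probability_Measure"
    "HOL-Computational_Algebra.Group_Closure"
begin

section \<open>Self-similar sets and measures\<close>

definition contracting_similarity :: "real \<Rightarrow> ('a::metric_space \<Rightarrow> 'a) \<Rightarrow> bool" where
  "contracting_similarity c f \<longleftrightarrow>
     0 < c \<and> c < 1 \<and> (\<forall>x y. dist (f x) (f y) = c * dist x y)"

definition self_similar_set ::
  "nat \<Rightarrow> (nat \<Rightarrow> 'a::metric_space \<Rightarrow> 'a) \<Rightarrow> 'a set \<Rightarrow> bool" where
  "self_similar_set N S K \<longleftrightarrow> K \<noteq> {} \<and> compact K \<and> K = (\<Union>i\<in>{1..N}. S i ` K)"

definition self_similar_measure ::
  "nat \<Rightarrow> (nat \<Rightarrow> 'a::metric_space \<Rightarrow> 'a) \<Rightarrow> (nat \<Rightarrow> real) \<Rightarrow> 'a measure \<Rightarrow> bool" where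
  "self_similar_measure N S p \<mu> \<longleftrightarrow>
     prob_space \<mu> \<and> sets \<mu> = sets borel \<and>
     (\<forall>A\<in>sets borel. measure \<mu> A = (\<Sum>i=1..N. p i * measure \<mu> (S i -` A)))"


section \<open>Strings\<close>

text \<open>
  A string is a list over \<open>{1..N}\<close>.  The parent of a non-empty string \<open>w\<close> is
  \<^term>\<open>butlast w\<close>, and \<open>string_prod a w\<close> is the product of the weights \<open>a\<close> of the letters
  of \<open>w\<close>, which is \<open>1\<close> for the empty string.
\<close>

definition strings :: "nat \<Rightarrow> nat list set" where
  "strings N = {w. w \<noteq> [] \<and> set w \<subseteq> {1..N}}"

definition string_prod :: "(nat \<Rightarrow> real) \<Rightarrow> nat list \<Rightarrow> real" where
  "string_prod a w = prod_list (map a w)"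

lemma string_prod_le_power:
  assumes "\<And>i. i \<in> {1..N} \<Longrightarrow> 0 < \<rho> i \<and> \<rho> i \<le> m" "set w \<subseteq> {1..N}"
  shows "0 < string_prod \<rho> w \<and> string_prod \<rho> w \<le> m ^ length w"
  using assms(2)
proof (induction w)
  case Nil
  then show ?case by (simp add: string_prod_def)
next
  case (Cons i w)
  then have i: "0 < \<rho> i" "\<rho> i \<le> m"
    and w: "0 < string_prod \<rho> w" "string_prod \<rho> w \<le> m ^ length w"
    using assms(1) by auto
  have "string_prod \<rho> (i # w) = \<rho> i * string_prod \<rho> w" by (simp add: string_prod_def)
  moreover have "\<rho> i * string_prod \<rho> w \<le> m * m ^ length w"
    using i w by (intro mult_mono) auto
  ultimately show ?case using i w by simp
qed

text \<open>
  The sums over strings occurring below range over subsets of the following set, so that they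
  are sums over finite sets.
\<close>

lemma finite_strings_parent_ge:
  assumes \<rho>: "\<And>i. i \<in> {1..N} \<Longrightarrow> 0 < \<rho> i \<and> \<rho> i < 1" and r: "0 < r"
  shows "finite {w \<in> strings N. r \<le> string_prod \<rho> (butlast w)}"
proof (cases "N = 0")
  case True
  then show ?thesis by (simp add: strings_def)
next
  case False
  define m where "m = Max (\<rho> ` {1..N})"
  have "m \<in> \<rho> ` {1..N}" unfolding m_def using False by (intro Max_in) auto
  then have m: "0 < m" "m < 1" using \<rho> by auto
  have le: "0 < \<rho> i \<and> \<rho> i \<le> m" if "i \<in> {1..N}" for i
    using that \<rho> unfolding m_def by auto
  obtain n where n: "m ^ n < r" using real_arch_pow_inv[OF r m(2)] by blast
  have "length w \<le> Suc n" if w: "w \<in> strings N" "r \<le> string_prod \<rho> (butlast w)" for w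
  proof (rule ccontr)
    assume "\<not> length w \<le> Suc n"
    then have "n \<le> length (butlast w)" by simp
    then have "m ^ length (butlast w) \<le> m ^ n" using m by (intro power_decreasing) auto
    moreover have "set (butlast w) \<subseteq> {1..N}"
      using w(1) by (auto simp: strings_def dest: in_set_butlastD)
    ultimately show False
      using string_prod_le_power[of N \<rho> m "butlast w", OF le] w(2) n by linarith
  qed
  then have "{w \<in> strings N. r \<le> string_prod \<rho> (butlast w)}
      \<subseteq> {w. set w \<subseteq> {1..N} \<and> length w \<le> Suc n}"
    by (auto simp: strings_def)
  then show ?thesis by (rule finite_subset) (rule finite_lists_length_le, simp)
qed


section \<open>The function \<open>\<beta>\<close>\<close>

definition beta :: "nat \<Rightarrow> (nat \<Rightarrow> real) \<Rightarrow> (nat \<Rightarrow> real) \<Rightarrow> real \<Rightarrow> real" where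
  "beta N p \<rho> q = (THE b. (\<Sum>i=1..N. p i powr q * \<rho> i powr b) = 1)"

lemma beta_ex1:
  fixes p \<rho> :: "nat \<Rightarrow> real"
  assumes "1 \<le> N" and p: "\<And>i. i \<in> {1..N} \<Longrightarrow> 0 < p i"
    and \<rho>: "\<And>i. i \<in> {1..N} \<Longrightarrow> 0 < \<rho> i \<and> \<rho> i < 1"
  shows "\<exists>!b. (\<Sum>i=1..N. p i powr q * \<rho> i powr b) = 1"
proof -
  define f where "f b = (\<Sum>i=1..N. p i powr q * \<rho> i powr b)" for b
  have anti: "f b < f a" if "a < b" for a b
    unfolding f_def
  proof (rule sum_strict_mono)
    fix i assume i: "i \<in> {1..N}"
    then have "\<rho> i powr b < \<rho> i powr a"
      using \<rho>[OF i] that by (intro powr_less_mono') auto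
    then show "p i powr q * \<rho> i powr b < p i powr q * \<rho> i powr a"
      using p[OF i] by (intro mult_strict_left_mono) auto
  qed (use assms(1) in auto)
  have "((\<lambda>b. p i powr q * \<rho> i powr b) \<longlongrightarrow> 0) at_top" if i: "i \<in> {1..N}" for i
  proof -
    have "ln (\<rho> i) < 0" using \<rho>[OF i] by simp
    then have "filterlim (\<lambda>b. b * ln (\<rho> i)) at_bot at_top"
      by (rule filterlim_tendsto_neg_mult_at_bot[OF tendsto_const _ filterlim_ident,
            where c = "ln (\<rho> i)", simplified mult.commute[of "ln (\<rho> i)"]])
    then have "((\<lambda>b. exp (b * ln (\<rho> i))) \<longlongrightarrow> 0) at_top"
      by (rule filterlim_compose[OF exp_at_bot])
    then have "((\<lambda>b. p i powr q * exp (b * ln (\<rho> i))) \<longlongrightarrow> 0) at_top"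
      by (rule tendsto_mult_right_zero)
    then show ?thesis using \<rho>[OF i] by (simp add: powr_def)
  qed
  then have "(f \<longlongrightarrow> (\<Sum>i=1..N. 0)) at_top"
    unfolding f_def by (intro tendsto_sum) auto
  then have "eventually (\<lambda>b. f b < 1) at_top"
    by (intro order_tendstoD) auto
  then obtain b1 where b1: "f b1 < 1"
    by (metis eventually_at_top_linorder order_refl)
  define b0 where "b0 = ln (p 1 powr q) / - ln (\<rho> 1)"
  have one: "1 \<in> {1..N}" using assms(1) by simp
  have ln1: "ln (\<rho> 1) < 0" using \<rho>[OF one] by simp
  have "\<rho> 1 powr b0 = exp (- ln (p 1 powr q))"
    using \<rho>[OF one] ln1 by (simp add: b0_def powr_def field_simps)
  then have "1 = p 1 powr q * \<rho> 1 powr b0"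
    using p[OF one] by (simp add: exp_minus powr_def[of "p _"])
  also have "\<dots> \<le> f b0"
    unfolding f_def using one
    by (intro member_le_sum[of 1 "{1..N}" "\<lambda>i. p i powr q * \<rho> i powr b0"]) auto
  finally have b0: "1 \<le> f b0" .
  have "b0 \<le> b1" using anti[of b1 b0] b0 b1 by linarith
  moreover have "continuous_on {b0..b1} f"
    unfolding f_def using \<rho> by (intro continuous_intros) force+
  ultimately obtain b where b: "f b = 1"
    using IVT2'[of f b1 1 b0] b0 b1 by auto
  show ?thesis
  proof (rule ex1I[of _ b])
    show "(\<Sum>i=1..N. p i powr q * \<rho> i powr b) = 1" using b by (simp add: f_def)
  next
    fix c assume "(\<Sum>i=1..N. p i powr q * \<rho> i powr c) = 1"
    then have "f c = f b" using b by (simp add: f_def)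
    then show "c = b" using anti[of c b] anti[of b c] by linarith
  qed
qed


section \<open>Symbolic multifractal Minkowski volumes\<close>

text \<open>
  Below, \<open>d\<close> is the dimension of the ambient space, \<open>\<rho>\<close> is the family of contraction ratios,
  and \<open>\<kappa> l\<close> stands for the coefficient \<open>\<kappa>\<close> with upper indices \<open>q, l\<close>.  The volume depends
  on the self-similar set and measure only through these data.
\<close>

definition sigma_ql :: "nat \<Rightarrow> nat \<Rightarrow> (nat \<Rightarrow> real) \<Rightarrow> (nat \<Rightarrow> real) \<Rightarrow> real \<Rightarrow> nat \<Rightarrow> real" where
  "sigma_ql d N p \<rho> q l = (\<Sum>i=1..N. p i powr q * \<rho> i powr (real l - real d * q))"

definition C_sym ::
  "nat \<Rightarrow> nat \<Rightarrow> (nat \<Rightarrow> real) \<Rightarrow> (nat \<Rightarrow> real) \<Rightarrow> real \<Rightarrow> nat \<Rightarrow> real \<Rightarrow> real" where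
  "C_sym d N p \<rho> q l r =
     (\<Sum>w\<in>{w \<in> strings N. string_prod \<rho> w < r \<and> r < string_prod \<rho> (butlast w)}.
        string_prod p w powr q * string_prod \<rho> w powr (real l - real d * q))
     + (1 + 1 / sigma_ql d N p \<rho> q l) / 2 *
       (\<Sum>w\<in>{w \<in> strings N. r = string_prod \<rho> (butlast w)}.
          string_prod p w powr q * string_prod \<rho> w powr (real l - real d * q))"

definition V_sym ::
  "nat \<Rightarrow> nat \<Rightarrow> (nat \<Rightarrow> real) \<Rightarrow> (nat \<Rightarrow> real) \<Rightarrow> (nat \<Rightarrow> real) \<Rightarrow> real \<Rightarrow> real \<Rightarrow> real" where
  "V_sym d N p \<rho> \<kappa> q r =
     (\<Sum>l=0..d. \<kappa> l * C_sym d N p \<rho> q l r * r powr (- real l + real d * q))"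


section \<open>Symbolic multifractal Minkowski measurability\<close>

definition sym_Minkowski_measurable ::
  "nat \<Rightarrow> nat \<Rightarrow> (nat \<Rightarrow> real) \<Rightarrow> (nat \<Rightarrow> real) \<Rightarrow> (nat \<Rightarrow> real) \<Rightarrow> real \<Rightarrow> real \<Rightarrow> bool" where
  "sym_Minkowski_measurable d N p \<rho> \<kappa> q t \<longleftrightarrow>
     (\<exists>M. ((\<lambda>r. 1 / r powr (- t) * V_sym d N p \<rho> \<kappa> q r) \<longlongrightarrow> M) (at_right 0))"

definition M_sym ::
  "nat \<Rightarrow> nat \<Rightarrow> (nat \<Rightarrow> real) \<Rightarrow> (nat \<Rightarrow> real) \<Rightarrow> (nat \<Rightarrow> real) \<Rightarrow> real \<Rightarrow> real \<Rightarrow> real" where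
  "M_sym d N p \<rho> \<kappa> q t =
     Lim (at_right 0) (\<lambda>r. 1 / r powr (- t) * V_sym d N p \<rho> \<kappa> q r)"

definition ave_integrand ::
  "nat \<Rightarrow> nat \<Rightarrow> (nat \<Rightarrow> real) \<Rightarrow> (nat \<Rightarrow> real) \<Rightarrow> (nat \<Rightarrow> real) \<Rightarrow> real \<Rightarrow> real \<Rightarrow> real \<Rightarrow> real" where
  "ave_integrand d N p \<rho> \<kappa> q t s = 1 / s powr (- t) * V_sym d N p \<rho> \<kappa> q s / s"

definition ave_V_sym ::
  "nat \<Rightarrow> nat \<Rightarrow> (nat \<Rightarrow> real) \<Rightarrow> (nat \<Rightarrow> real) \<Rightarrow> (nat \<Rightarrow> real) \<Rightarrow> real \<Rightarrow> real \<Rightarrow> real \<Rightarrow> real" where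
  "ave_V_sym d N p \<rho> \<kappa> q t r =
     1 / (- ln r) * (LBINT s:{r..1}. ave_integrand d N p \<rho> \<kappa> q t s)"

text \<open>
  Since the Lebesgue integral of a non-integrable function is \<open>0\<close> by convention, the existence
  of the integrals is made an explicit part of average measurability.
\<close>

definition ave_sym_Minkowski_measurable ::
  "nat \<Rightarrow> nat \<Rightarrow> (nat \<Rightarrow> real) \<Rightarrow> (nat \<Rightarrow> real) \<Rightarrow> (nat \<Rightarrow> real) \<Rightarrow> real \<Rightarrow> real \<Rightarrow> bool" where
  "ave_sym_Minkowski_measurable d N p \<rho> \<kappa> q t \<longleftrightarrow>
     (\<forall>r. 0 < r \<and> r < 1 \<longrightarrow>
        set_integrable lborel {r..1} (ave_integrand d N p \<rho> \<kappa> q t)) \<and>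
     (\<exists>M. (ave_V_sym d N p \<rho> \<kappa> q t \<longlongrightarrow> M) (at_right 0))"

definition M_ave_sym ::
  "nat \<Rightarrow> nat \<Rightarrow> (nat \<Rightarrow> real) \<Rightarrow> (nat \<Rightarrow> real) \<Rightarrow> (nat \<Rightarrow> real) \<Rightarrow> real \<Rightarrow> real \<Rightarrow> real" where
  "M_ave_sym d N p \<rho> \<kappa> q t = Lim (at_right 0) (ave_V_sym d N p \<rho> \<kappa> q t)"


section \<open>Arithmetic and non-arithmetic case, and the limits\<close>

definition discrete_additive_subgroup :: "real set \<Rightarrow> bool" where
  "discrete_additive_subgroup G \<longleftrightarrow>
     0 \<in> G \<and> (\<forall>x\<in>G. \<forall>y\<in>G. x + y \<in> G) \<and> (\<forall>x\<in>G. - x \<in> G) \<and> discrete G"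

definition arithmetic :: "nat \<Rightarrow> (nat \<Rightarrow> real) \<Rightarrow> bool" where
  "arithmetic N \<rho> \<longleftrightarrow>
     (\<exists>G. discrete_additive_subgroup G \<and> (\<lambda>i. ln (inverse (\<rho> i))) ` {1..N} \<subseteq> G)"

definition c_sym ::
  "nat \<Rightarrow> nat \<Rightarrow> (nat \<Rightarrow> real) \<Rightarrow> (nat \<Rightarrow> real) \<Rightarrow> (nat \<Rightarrow> real) \<Rightarrow> real \<Rightarrow> real" where
  "c_sym d N p \<rho> \<kappa> q =
     - (1 / (\<Sum>i=1..N. p i powr q * \<rho> i powr beta N p \<rho> q * ln (\<rho> i))) *
     (\<Sum>l=0..d. \<kappa> l * (sigma_ql d N p \<rho> q l - 1) / (beta N p \<rho> q - (real l - real d * q)))"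

text \<open>In \<open>theta_sym u a r\<close> the number \<open>a\<close> plays the role of \<open>\<beta> - (l - d q)\<close>.\<close>

definition theta_sym :: "real \<Rightarrow> real \<Rightarrow> real \<Rightarrow> real" where
  "theta_sym u a r =
     (if r \<in> range (\<lambda>n::int. exp (of_int n * u))
      then (exp (- u * a) + 1) / 2
      else exp (- u * a * frac (- (ln r / u))))"

definition pi_sym ::
  "nat \<Rightarrow> nat \<Rightarrow> (nat \<Rightarrow> real) \<Rightarrow> (nat \<Rightarrow> real) \<Rightarrow> (nat \<Rightarrow> real) \<Rightarrow> real \<Rightarrow> real \<Rightarrow> real \<Rightarrow> real" where
  "pi_sym d N p \<rho> \<kappa> q u r =
     - (1 / (\<Sum>i=1..N. p i powr q * \<rho> i powr beta N p \<rho> q * ln (\<rho> i))) * u *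
     (\<Sum>l=0..d. \<kappa> l * (sigma_ql d N p \<rho> q l - 1)
                  / (1 - exp (- u * (beta N p \<rho> q - (real l - real d * q))))
                  * theta_sym u (beta N p \<rho> q - (real l - real d * q)) r)"

end

theory Submission
  imports Defs
begin

text \<open>
  Put \<open>t = - ln r\<close>, \<open>x i = - ln (\<rho> i)\<close>, \<open>w i = p i powr q * \<rho> i powr \<beta>\<close> and \<open>a l = \<beta> - (l - d * q)\<close>.
  The weights \<open>w\<close> sum to \<open>1\<close> by the choice of \<open>\<beta>\<close>, so they are the step probabilities of a random walk
  with positive steps \<open>x i\<close>.  A string contributes to \<open>C_sym\<close> only while \<open>r\<close> lies between its own
  ratio and the ratio of its parent.  Grouping strings by their parents therefore writes
  \<open>r powr \<beta>\<close> times the symbolic volume as the renewal sum \<open>\<Sum>v. W v * h (t - X v)\<close> over all words \<open>v\<close>,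
  where \<open>W v\<close> is the probability and \<open>X v\<close> the endpoint of the path \<open>v\<close>, and \<open>h\<close> is an explicit bounded
  kernel with bounded support, built from exponentials \<open>exp (- a l * s)\<close> on the intervals \<open>(0, x i)\<close> and
  a point value at \<open>0\<close> (lemma \<open>V_sym_eq_renewal\<close>).  The theorem is the renewal theorem for this sum, and
  \<open>c_sym\<close> is the integral of \<open>h\<close> divided by the mean step.
  
  The renewal theorem is proved in an elementary way that covers lattice and non-lattice steps together.
  Beyond the support of its kernel, a renewal sum \<open>Z\<close> satisfies \<open>Z t = (\<Sum>i. w i * Z (t - x i))\<close>.
  Endpoints of words become dense in the group generated by the steps
  (\<open>X_asymptotically_dense_in_step_group\<close>), so a value close to the limit superior forces \<open>Z\<close> to be close
  to it on a whole window, and averaging propagates this to infinity: \<open>Z\<close> converges along the group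
  (\<open>harmonic_converges\<close>).  The limit is identified by applying the renewal equation to a primitive of the
  kernel.
  
  In the non-arithmetic case the group is dense, which gives the limit for continuous kernels
  (\<open>renewal_tendsto_continuous\<close>) and, by squeezing, for kernels with jumps (\<open>renewal_tendsto_interval\<close>).
  In the arithmetic case the mass of the renewal measure at the points of \<open>u\<int>\<close> converges, and the
  renewal sum approaches the periodic sum of \<open>h\<close> over a shifted lattice (\<open>renewal_lattice\<close>), which geometric
  series evaluate to \<open>pi_sym\<close> (\<open>lattice_profile\<close>).  For the averages, the integral
  of a renewal sum up to \<open>T\<close> is itself a renewal sum of linear growth (\<open>renewal_average\<close>).
\<close>

section \<open>Random walks with finitely many positive steps\<close>

text \<open>
  A random walk on the line starts at \<open>0\<close> and takes the step \<open>x i > 0\<close> with probability \<open>w i\<close>.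
  A word \<open>v\<close> is a finite path: \<open>W v\<close> is its probability and \<open>X v\<close> its endpoint.
\<close>

locale finite_renewal =
  fixes A :: "'a set" and w x :: "'a \<Rightarrow> real"
  assumes finite_A: "finite A"
    and w_pos: "\<And>i. i \<in> A \<Longrightarrow> 0 < w i"
    and w_sum: "sum w A = 1"
    and x_pos: "\<And>i. i \<in> A \<Longrightarrow> 0 < x i"
begin

definition W :: "'a list \<Rightarrow> real" where "W v = prod_list (map w v)"

definition X :: "'a list \<Rightarrow> real" where "X v = sum_list (map x v)"

definition words :: "real \<Rightarrow> 'a list set" where
  "words s = {v. set v \<subseteq> A \<and> X v \<le> s}"

definition x_min :: real where "x_min = Min (x ` A)"

definition x_max :: real where "x_max = Max (x ` A)"

definition mean :: real where "mean = (\<Sum>i\<in>A. w i * x i)"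

lemma A_nonempty: "A \<noteq> {}"
  using w_sum by auto

lemma x_min_pos: "0 < x_min" and x_min_le: "i \<in> A \<Longrightarrow> x_min \<le> x i"
  unfolding x_min_def using finite_A A_nonempty x_pos by auto

lemma x_max_ge: "i \<in> A \<Longrightarrow> x i \<le> x_max"
  unfolding x_max_def using finite_A by auto

lemma x_max_pos: "0 < x_max"
  using A_nonempty x_pos x_max_ge by (metis ex_in_conv less_le_trans)

lemma mean_pos: "0 < mean"
  unfolding mean_def using finite_A A_nonempty w_pos x_pos by (intro sum_pos) auto

lemma W_simps [simp]: "W [] = 1" "W (i # v) = w i * W v" "W (v @ v') = W v * W v'"
  by (simp_all add: W_def)

lemma X_simps [simp]: "X [] = 0" "X (i # v) = x i + X v" "X (v @ v') = X v + X v'"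
  by (simp_all add: X_def)

lemma W_pos: "set v \<subseteq> A \<Longrightarrow> 0 < W v"
  using w_pos by (induction v) auto

lemma X_ge: "set v \<subseteq> A \<Longrightarrow> real (length v) * x_min \<le> X v"
proof (induction v)
  case (Cons i v)
  then show ?case using x_min_le[of i] by (simp add: algebra_simps)
qed simp

lemma X_nonneg: "set v \<subseteq> A \<Longrightarrow> 0 \<le> X v"
  using X_ge[of v] x_min_pos by (meson mult_nonneg_nonneg of_nat_0_le_iff less_imp_le order_trans)

lemma finite_words: "finite (words s)"
proof -
  have "length v \<le> nat \<lfloor>s / x_min\<rfloor>" if "set v \<subseteq> A" "X v \<le> s" for v
  proof -
    have "real (length v) * x_min \<le> s" using X_ge[of v] that by linarith
    then have "real (length v) \<le> s / x_min" using x_min_pos by (simp add: field_simps)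
    then show ?thesis by linarith
  qed
  then have "words s \<subseteq> {v. set v \<subseteq> A \<and> length v \<le> nat \<lfloor>s / x_min\<rfloor>}"
    by (auto simp: words_def)
  then show ?thesis by (rule finite_subset) (rule finite_lists_length_le[OF finite_A])
qed

lemma words_empty: "s < 0 \<Longrightarrow> words s = {}"
  using X_nonneg by (force simp: words_def)

lemma words_rec: "0 \<le> s \<Longrightarrow> words s = insert [] (\<Union>i\<in>A. (#) i ` words (s - x i))"
proof (rule set_eqI)
  fix v
  assume "0 \<le> s"
  then show "v \<in> words s \<longleftrightarrow> v \<in> insert [] (\<Union>i\<in>A. (#) i ` words (s - x i))"
    by (cases v) (auto simp: words_def algebra_simps)
qed

text \<open>
  Splitting off the first letter of a word is the only combinatorial input: it turns sums over
  words into the renewal equation.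
\<close>

lemma sum_words_rec:
  assumes "0 \<le> s"
  shows "sum f (words s) = f [] + (\<Sum>i\<in>A. \<Sum>v\<in>words (s - x i). f (i # v))"
proof -
  have "sum f (words s) = f [] + sum f (\<Union>i\<in>A. (#) i ` words (s - x i))"
    unfolding words_rec[OF assms] using finite_A finite_words
    by (intro sum.insert) auto
  also have "sum f (\<Union>i\<in>A. (#) i ` words (s - x i)) = (\<Sum>i\<in>A. sum f ((#) i ` words (s - x i)))"
    using finite_A finite_words by (intro sum.UNION_disjoint) auto
  also have "\<dots> = (\<Sum>i\<in>A. \<Sum>v\<in>words (s - x i). f (i # v))"
    by (intro sum.cong sum.reindex_cong[OF _ refl]) (auto intro: inj_onI)
  finally show ?thesis .
qed

section \<open>Renewal sums\<close>

text \<open>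
  This is the convolution of \<open>h\<close> with the renewal measure, the sum of \<open>W v\<close> times the unit mass
  at \<open>X v\<close> over all words \<open>v\<close>.  For \<open>h\<close> vanishing on \<open>(-\<infinity>, -1)\<close> the truncation to
  \<open>X v \<le> t + 1\<close> drops only zero terms and makes the sum finite.  The kernels of interest
  live on \<open>[0, \<infinity>)\<close>; the extra unit to the left of \<open>0\<close> is room for their continuous majorants.
\<close>

definition renewal :: "(real \<Rightarrow> real) \<Rightarrow> real \<Rightarrow> real" where
  "renewal h t = (\<Sum>v\<in>words (t + 1). W v * h (t - X v))"

lemma renewal_superset:
  assumes h: "\<And>s. s < -1 \<Longrightarrow> h s = 0" and s: "t + 1 \<le> s"
  shows "renewal h t = (\<Sum>v\<in>words s. W v * h (t - X v))"
  unfolding renewal_def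
proof (rule sum.mono_neutral_left)
  show "\<forall>v\<in>words s - words (t + 1). W v * h (t - X v) = 0"
  proof
    fix v assume "v \<in> words s - words (t + 1)"
    then have "t - X v < -1" by (auto simp: words_def)
    then show "W v * h (t - X v) = 0" using h by simp
  qed
qed (use s finite_words in \<open>auto simp: words_def\<close>)

lemma renewal_eq:
  assumes h: "\<And>s. s < -1 \<Longrightarrow> h s = 0"
  shows "renewal h t = h t + (\<Sum>i\<in>A. w i * renewal h (t - x i))"
proof (cases "0 \<le> t + 1")
  case True
  show ?thesis
    unfolding renewal_def sum_words_rec[OF True]
    by (simp add: sum_distrib_left mult_ac algebra_simps)
next
  case False
  then have "words (t - x i + 1) = {}" if "i \<in> A" for i
    using x_pos[OF that] by (intro words_empty) auto
  then show ?thesis using False h[of t] words_empty[of "t + 1"] by (simp add: renewal_def)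
qed

lemma renewal_neg: "t < -1 \<Longrightarrow> renewal h t = 0"
  by (simp add: renewal_def words_empty)

lemma renewal_mono:
  assumes "\<And>s. f s \<le> g s"
  shows "renewal f t \<le> renewal g t"
  unfolding renewal_def using assms W_pos
  by (intro sum_mono mult_left_mono) (auto simp: words_def less_imp_le)

lemma renewal_sum:
  "renewal (\<lambda>s. \<Sum>j\<in>J. c j * h j s) t = (\<Sum>j\<in>J. c j * renewal (h j) t)"
  unfolding renewal_def sum_distrib_left
  by (subst sum.swap) (simp add: mult_ac)

lemma renewal_diff: "renewal (\<lambda>s. f s - g s) t = renewal f t - renewal g t"
  unfolding renewal_def by (simp add: sum_subtractf algebra_simps)

lemma renewal_add: "renewal (\<lambda>s. f s + g s) t = renewal f t + renewal g t"
  unfolding renewal_def by (simp add: sum.distrib algebra_simps)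

lemma renewal_cmult: "renewal (\<lambda>s. c * f s) t = c * renewal f t"
  unfolding renewal_def by (simp add: sum_distrib_left algebra_simps)

lemma renewal_shift:
  assumes h: "\<And>s. s < -1 \<Longrightarrow> h s = 0" and "0 \<le> \<eta>"
  shows "renewal (\<lambda>s. h (s - \<eta>)) t = renewal h (t - \<eta>)"
  using renewal_superset[of h "t - \<eta>" "t + 1", OF h] assms(2)
  by (simp add: renewal_def algebra_simps)

text \<open>
  The walk advances by at least \<open>x_min\<close> in every step, so it visits an interval of length
  \<open>k * x_min\<close> at most \<open>k\<close> times.  In terms of the renewal equation: advancing by \<open>x_min\<close> adds
  at most \<open>e\<close> to a bound, and from \<open>-1 + k * x_min\<close> on values of the renewal sum are averages of
  earlier ones.
\<close>

lemma abs_renewal_le: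
  assumes h: "\<And>s. s < -1 \<Longrightarrow> h s = 0"
    and supp: "\<And>s. -1 + real k * x_min \<le> s \<Longrightarrow> h s = 0"
    and le: "\<And>s. \<bar>h s\<bar> \<le> e"
  shows "\<bar>renewal h t\<bar> \<le> real k * e"
proof -
  have e: "0 \<le> e" using le[of 0] by linarith
  have eq: "renewal h t = h t + (\<Sum>i\<in>A. w i * renewal h (t - x i))" for t
    by (rule renewal_eq) (rule h)
  have *: "\<bar>renewal h t\<bar> \<le> real (min n k) * e" if "t < -1 + real n * x_min" for n t
    using that
  proof (induction n arbitrary: t)
    case 0
    then show ?case by (simp add: renewal_neg)
  next
    case (Suc n)
    show ?case
    proof (cases "t < -1 + real n * x_min")
      case True
      have "real (min n k) * e \<le> real (min (Suc n) k) * e"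
        using e by (intro mult_right_mono) auto
      then show ?thesis using Suc.IH[OF True] by linarith
    next
      case False
      have "t - x i < -1 + real n * x_min" if "i \<in> A" for i
        using Suc.prems x_min_le[OF that] by (simp add: algebra_simps)
      then have "\<bar>w i * renewal h (t - x i)\<bar> \<le> w i * (real (min n k) * e)" if "i \<in> A" for i
        using Suc.IH[of "t - x i"] that w_pos[OF that]
        by (auto simp: abs_mult intro!: mult_left_mono)
      then have "\<bar>\<Sum>i\<in>A. w i * renewal h (t - x i)\<bar> \<le> (\<Sum>i\<in>A. w i * (real (min n k) * e))"
        by (intro order_trans[OF sum_abs] sum_mono)
      also have "\<dots> = real (min n k) * e" by (simp add: w_sum flip: sum_distrib_right)
      finally have S: "\<bar>\<Sum>i\<in>A. w i * renewal h (t - x i)\<bar> \<le> real (min n k) * e" .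
      show ?thesis
      proof (cases "n < k")
        case True
        then have "real (min (Suc n) k) * e = real (min n k) * e + e" by (simp add: algebra_simps)
        then show ?thesis using S le[of t] eq[of t] by linarith
      next
        case k: False
        have "real k * x_min \<le> real n * x_min" using k x_min_pos by (intro mult_right_mono) auto
        then have "h t = 0" using False by (intro supp) linarith
        moreover have "real (min (Suc n) k) * e = real (min n k) * e" using k by (simp add: min_def)
        ultimately show ?thesis using S eq[of t] by linarith
      qed
    qed
  qed
  obtain n where "t + 1 < real n * x_min" using ex_less_of_nat_mult[OF x_min_pos] by blast
  then have "\<bar>renewal h t\<bar> \<le> real (min n k) * e" by (intro *) linarith
  also have "\<dots> \<le> real k * e" using e by (intro mult_right_mono) auto
  finally show ?thesis .
qed

section \<open>Functions equal to their averages over one step back\<close>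

text \<open>
  Minimum principle: beyond \<open>T\<close> each value is an average of values at most \<open>x_max\<close> further left,
  so a lower bound on a window of length \<open>x_max\<close> propagates to the right.
\<close>

lemma harmonic_ge:
  assumes G: "\<And>t i. t \<in> G \<Longrightarrow> i \<in> A \<Longrightarrow> t - x i \<in> G"
    and Z: "\<And>t. t \<in> G \<Longrightarrow> T \<le> t \<Longrightarrow> Z t = (\<Sum>i\<in>A. w i * Z (t - x i))"
    and a: "\<And>t. t \<in> G \<Longrightarrow> T - x_max \<le> t \<Longrightarrow> t \<le> T \<Longrightarrow> a \<le> Z t"
    and t: "t \<in> G" "T - x_max \<le> t"
  shows "a \<le> Z t"
proof -
  have *: "a \<le> Z t" if "t \<in> G" "T - x_max \<le> t" "t < T + real n * x_min" for n t
    using that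
  proof (induction n arbitrary: t)
    case 0
    then show ?case using a by auto
  next
    case (Suc n)
    show ?case
    proof (cases "T \<le> t")
      case True
      have "a \<le> Z (t - x i)" if "i \<in> A" for i
        using x_min_le[OF that] x_max_ge[OF that] Suc.prems True G[OF _ that]
        by (intro Suc.IH) (auto simp: algebra_simps)
      then have "(\<Sum>i\<in>A. w i * a) \<le> (\<Sum>i\<in>A. w i * Z (t - x i))"
        using w_pos by (intro sum_mono mult_left_mono) (auto simp: less_imp_le)
      then show ?thesis using Z Suc.prems True by (simp add: w_sum flip: sum_distrib_right)
    next
      case False
      then show ?thesis using a Suc.prems by auto
    qed
  qed
  obtain n where "t - T < real n * x_min" using ex_less_of_nat_mult[OF x_min_pos] by blast
  then show ?thesis using t by (intro *[of t n]) auto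
qed

text \<open>
  A non-negative average is at least any single term of it.  Iterating this along a word shows that
  if \<open>D\<close> is small at \<open>t\<close>, it is small at every point from which the walk reaches \<open>t\<close> by a word of
  non-negligible probability.
\<close>

lemma harmonic_word_le:
  assumes G: "\<And>t i. t \<in> G \<Longrightarrow> i \<in> A \<Longrightarrow> t - x i \<in> G"
    and D: "\<And>t. t \<in> G \<Longrightarrow> T \<le> t \<Longrightarrow> D t = (\<Sum>i\<in>A. w i * D (t - x i))"
    and nonneg: "\<And>t. t \<in> G \<Longrightarrow> T - x_max \<le> t \<Longrightarrow> 0 \<le> D t"
    and v: "set v \<subseteq> A" and t: "t \<in> G" "T \<le> t - X v"
  shows "W v * D (t - X v) \<le> D t"
  using v t
proof (induction v arbitrary: t)
  case (Cons i v)
  then have i: "i \<in> A" and v: "set v \<subseteq> A" by auto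
  have t: "T \<le> t" using Cons.prems(3) x_pos[OF i] X_nonneg[OF v] by simp
  have "W v * D (t - x i - X v) \<le> D (t - x i)"
    using Cons.prems G i v by (intro Cons.IH) (auto simp: algebra_simps)
  then have "w i * (W v * D (t - x i - X v)) \<le> w i * D (t - x i)"
    using w_pos[OF i] by (intro mult_left_mono) auto
  also have "\<dots> \<le> (\<Sum>j\<in>A. w j * D (t - x j))"
  proof (rule member_le_sum[OF i _ finite_A])
    fix j assume "j \<in> A - {i}"
    then have j: "j \<in> A" by simp
    show "0 \<le> w j * D (t - x j)"
      using w_pos[OF j] x_max_ge[OF j] t G[OF Cons.prems(2) j]
      by (intro mult_nonneg_nonneg nonneg) auto
  qed
  also have "\<dots> = D t" using D[OF Cons.prems(2) t] by simp
  finally show ?case by (simp add: algebra_simps)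
qed simp

section \<open>The group generated by the steps\<close>

text \<open>
  The differences of endpoints form the additive group generated by the steps.  It is dense in the
  non-arithmetic case and a lattice in the arithmetic case; the arguments up to the convergence
  theorem treat both cases at once.
\<close>

definition step_group :: "real set" where
  "step_group = {X v - X v' | v v'. set v \<subseteq> A \<and> set v' \<subseteq> A}"

lemma X_in_step_group: "set v \<subseteq> A \<Longrightarrow> X v \<in> step_group"
  unfolding step_group_def
  by (simp, intro exI[of _ v] exI[of _ "[]"]) simp

lemma x_in_step_group: "i \<in> A \<Longrightarrow> x i \<in> step_group"
  using X_in_step_group[of "[i]"] by simp

lemma step_group_diff:
  assumes "y \<in> step_group" "z \<in> step_group"
  shows "y - z \<in> step_group"
proof -
  obtain a b c e where *: "y = X a - X b" "z = X c - X e"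
    and sub: "set a \<subseteq> A" "set b \<subseteq> A" "set c \<subseteq> A" "set e \<subseteq> A"
    using assms by (auto simp: step_group_def)
  have "y - z = X (a @ e) - X (b @ c)" using * by simp
  moreover have "set (a @ e) \<subseteq> A" "set (b @ c) \<subseteq> A" using sub by auto
  ultimately show ?thesis unfolding step_group_def by blast
qed

lemma zero_in_step_group: "0 \<in> step_group"
  using X_in_step_group[of "[]"] by simp

lemma step_group_uminus: "y \<in> step_group \<Longrightarrow> - y \<in> step_group"
  using step_group_diff[OF zero_in_step_group, of y] by simp

lemma step_group_add: "y \<in> step_group \<Longrightarrow> z \<in> step_group \<Longrightarrow> y + z \<in> step_group"
  using step_group_diff[of y "- z"] step_group_uminus[of z] by simp

lemma step_group_mult_nat: "y \<in> step_group \<Longrightarrow> real n * y \<in> step_group"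
  by (induction n) (auto simp: zero_in_step_group algebra_simps intro: step_group_add)

lemma step_group_mult_int: "y \<in> step_group \<Longrightarrow> of_int k * y \<in> step_group"
  using step_group_mult_nat[of y "nat \<bar>k\<bar>"] step_group_uminus[of "real (nat \<bar>k\<bar>) * y"]
  by (cases "0 \<le> k") auto

lemma X_replicate: "X (replicate n i) = real n * x i"
  by (simp add: X_def sum_list_replicate)

text \<open>
  A group element becomes an endpoint when a suitable endpoint is added to it, and finitely many
  group elements can share the same translation.
\<close>

lemma ex_common_translate:
  assumes "finite F" "F \<subseteq> step_group"
  shows "\<exists>b. 0 \<le> b \<and> b \<in> step_group \<and> (\<forall>g\<in>F. \<exists>v. set v \<subseteq> A \<and> X v = b + g)"
  using assms
proof (induction F)
  case empty
  then show ?case using zero_in_step_group by auto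
next
  case (insert g F)
  then obtain b where b: "0 \<le> b" "b \<in> step_group" "\<And>g. g \<in> F \<Longrightarrow> \<exists>v. set v \<subseteq> A \<and> X v = b + g"
    by auto
  have bF: "\<exists>v. set v \<subseteq> A \<and> X v = b + g" if "g \<in> F" for g using b(3) that by blast
  obtain u u' where u: "g = X u - X u'" "set u \<subseteq> A" "set u' \<subseteq> A"
    using insert.prems by (auto simp: step_group_def)
  obtain c c' where c: "b = X c - X c'" "set c \<subseteq> A" "set c' \<subseteq> A"
    using b(2) by (auto simp: step_group_def)
  show ?case
  proof (intro exI[of _ "b + X (c' @ u')"] conjI ballI)
    have s: "set (c' @ u') \<subseteq> A" using u c by auto
    show "0 \<le> b + X (c' @ u')" using b(1) X_nonneg[OF s] by simp
    show "b + X (c' @ u') \<in> step_group" using b(2) X_in_step_group[OF s] by (rule step_group_add)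
    fix f assume "f \<in> insert g F"
    then consider "f = g" | "f \<in> F" by auto
    then show "\<exists>v. set v \<subseteq> A \<and> X v = b + X (c' @ u') + f"
    proof cases
      case 1
      then show ?thesis using u c by (intro exI[of _ "c @ u"]) auto
    next
      case 2
      then obtain v where "set v \<subseteq> A" "X v = b + f" using bF by blast
      then show ?thesis using s by (intro exI[of _ "v @ c' @ u'"]) auto
    qed
  qed
qed

lemma finite_net:
  fixes S :: "real set"
  assumes "0 < \<delta>" "bounded S"
  shows "\<exists>F. finite F \<and> F \<subseteq> S \<and> (\<forall>y\<in>S. \<exists>g\<in>F. \<bar>g - y\<bar> \<le> \<delta>)"
proof -
  have "compact (closure S)" using assms(2) by simp
  then have "\<exists>D\<subseteq>S. finite D \<and> closure S \<subseteq> (\<Union>c\<in>D. ball c \<delta>)"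
  proof (rule compactE_image[of _ S "\<lambda>c. ball c \<delta>"])
    show "closure S \<subseteq> (\<Union>c\<in>S. ball c \<delta>)"
      using assms(1) by (auto simp: closure_approachable)
  qed auto
  then obtain D where D: "D \<subseteq> S" "finite D" "closure S \<subseteq> (\<Union>c\<in>D. ball c \<delta>)" by blast
  have "\<exists>g\<in>D. \<bar>g - y\<bar> \<le> \<delta>" if "y \<in> S" for y
  proof -
    have "y \<in> (\<Union>c\<in>D. ball c \<delta>)" using D(3) closure_subset that by blast
    then show ?thesis by (auto simp: dist_real_def intro: less_imp_le)
  qed
  then show ?thesis using D by blast
qed

text \<open>
  Far out, the endpoints fill the group up to an error \<open>\<delta>\<close>.  Modulo one step \<open>x i\<close> it suffices to
  reach a finite \<open>\<delta>\<close>-net of the part of the group in \<open>[0, x i]\<close>; a common translate \<open>b\<close> of the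
  net consists of endpoints, and appending copies of the letter \<open>i\<close> moves it to the right.
\<close>

lemma X_asymptotically_dense_in_step_group:
  assumes "0 < \<delta>"
  shows "\<exists>B\<ge>0. \<forall>y\<in>step_group. B \<le> y \<longrightarrow> (\<exists>v. set v \<subseteq> A \<and> \<bar>X v - y\<bar> \<le> \<delta>)"
proof -
  obtain i where i: "i \<in> A" using A_nonempty by auto
  define S where "S = step_group \<inter> {0..x i}"
  have "bounded S" by (auto simp: S_def intro: bounded_subset[of "{0..x i}"])
  then obtain F where F: "finite F" "F \<subseteq> S" "\<And>y. y \<in> S \<Longrightarrow> \<exists>g\<in>F. \<bar>g - y\<bar> \<le> \<delta>"
    using finite_net[OF assms] by meson
  have "F \<subseteq> step_group" using F(2) by (auto simp: S_def)
  then obtain b where b: "0 \<le> b" "b \<in> step_group"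
    and bF: "\<And>g. g \<in> F \<Longrightarrow> \<exists>v. set v \<subseteq> A \<and> X v = b + g"
    using ex_common_translate[OF F(1)] by blast
  show ?thesis
  proof (intro exI[of _ b] conjI ballI impI)
    fix y assume y: "y \<in> step_group" "b \<le> y"
    define k where "k = \<lfloor>(y - b) / x i\<rfloor>"
    have xi: "0 < x i" using x_pos i by blast
    have k0: "0 \<le> k" using y xi by (simp add: k_def)
    define z where "z = y - b - of_int k * x i"
    have "of_int k \<le> (y - b) / x i" "(y - b) / x i < of_int k + 1" unfolding k_def by linarith+
    then have "of_int k * x i \<le> y - b" "y - b \<le> of_int k * x i + x i"
      using xi by (auto simp: field_simps)
    moreover have "z \<in> step_group"
      unfolding z_def using y b x_in_step_group[OF i] by (intro step_group_diff step_group_mult_int)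
    ultimately have "z \<in> S" by (auto simp: S_def z_def)
    then obtain g where g: "g \<in> F" "\<bar>g - z\<bar> \<le> \<delta>" using F(3) by blast
    then obtain v where v: "set v \<subseteq> A" "X v = b + g" using bF by blast
    have "X (replicate (nat k) i @ v) - y = g - z"
      using k0 v by (simp add: X_replicate z_def)
    then show "\<exists>v. set v \<subseteq> A \<and> \<bar>X v - y\<bar> \<le> \<delta>"
      using g v i by (intro exI[of _ "replicate (nat k) i @ v"]) (auto simp: set_replicate_conv_if)
  qed (rule b(1))
qed

end

context finite_renewal
begin

section \<open>Convergence along the step group\<close>

text \<open>
  Let \<open>M\<close> be the limit superior of \<open>Z\<close> along the group.  At arbitrarily large \<open>s\<close> the value \<open>Z s\<close>
  is close to \<open>M\<close> while \<open>Z\<close> hardly exceeds \<open>M\<close> anywhere to the right of some point.  Since \<open>Z s\<close> is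
  an average, \<open>Z\<close> must then be close to \<open>M\<close> at all points \<open>s - X v\<close> with \<open>v\<close> from a fixed finite set
  of words, hence by asymptotic density and uniform continuity on a whole window of length \<open>x_max\<close>.
  The minimum principle carries this lower bound to infinity, so the limit inferior is \<open>M\<close> too.
\<close>

theorem harmonic_converges:
  assumes eq: "\<And>t. t \<in> step_group \<Longrightarrow> T \<le> t \<Longrightarrow> Z t = (\<Sum>i\<in>A. w i * Z (t - x i))"
    and cont: "\<And>e. 0 < e \<Longrightarrow>
      \<exists>\<delta>>0. \<forall>s\<in>step_group. \<forall>t\<in>step_group. \<bar>s - t\<bar> \<le> \<delta> \<longrightarrow> \<bar>Z s - Z t\<bar> \<le> e"
    and bound: "\<And>t. t \<in> step_group \<Longrightarrow> \<bar>Z t\<bar> \<le> C"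
  obtains c where "\<And>e. 0 < e \<Longrightarrow> \<exists>T. \<forall>t\<in>step_group. T \<le> t \<longrightarrow> \<bar>Z t - c\<bar> \<le> e"
proof -
  have G: "t - x i \<in> step_group" if "t \<in> step_group" "i \<in> A" for t i
    using step_group_diff[OF that(1) x_in_step_group[OF that(2)]] .
  have cofinal: "\<exists>t\<in>step_group. T \<le> t" for T
  proof -
    obtain i where i: "i \<in> A" using A_nonempty by auto
    obtain n where "T < real n * x i" using ex_less_of_nat_mult[OF x_pos[OF i]] by blast
    then show ?thesis using step_group_mult_nat[OF x_in_step_group[OF i], of n]
      by (intro bexI[of _ "real n * x i"]) auto
  qed
  define E where "E = {a. \<exists>T. \<forall>t\<in>step_group. T \<le> t \<longrightarrow> Z t \<le> a}"
  define M where "M = Inf E"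
  have "C \<in> E" using bound by (force simp: E_def abs_le_iff)
  then have E_ne: "E \<noteq> {}" by auto
  have E_bdd: "bdd_below E"
  proof (rule bdd_belowI)
    fix a assume "a \<in> E"
    then obtain T where T: "\<forall>t\<in>step_group. T \<le> t \<longrightarrow> Z t \<le> a" by (auto simp: E_def)
    obtain t where "t \<in> step_group" "T \<le> t" using cofinal by blast
    then show "- C \<le> a" using T bound[of t] by (force simp: abs_le_iff)
  qed
  have upper: "\<exists>T. \<forall>t\<in>step_group. T \<le> t \<longrightarrow> Z t \<le> M + e" if e: "0 < e" for e
  proof -
    obtain a where "a \<in> E" "a < M + e"
      using cInf_lessD[OF E_ne, of "M + e"] e by (auto simp: M_def)
    then show ?thesis unfolding E_def by (force intro: less_imp_le)
  qed
  have frequently: "\<exists>s\<in>step_group. T \<le> s \<and> M - e < Z s" if e: "0 < e" for e T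
  proof (rule ccontr)
    assume "\<not> ?thesis"
    then have "M - e \<in> E" unfolding E_def by (auto simp: not_less intro!: exI[of _ T])
    then show False using cInf_lower[OF _ E_bdd] e by (force simp: M_def)
  qed
  have lower: "\<exists>T. \<forall>t\<in>step_group. T \<le> t \<longrightarrow> M - 2 * e \<le> Z t" if e: "0 < e" for e
  proof -
    obtain \<delta> where \<delta>: "0 < \<delta>"
      and Z\<delta>: "\<And>s t. s \<in> step_group \<Longrightarrow> t \<in> step_group \<Longrightarrow> \<bar>s - t\<bar> \<le> \<delta> \<Longrightarrow> \<bar>Z s - Z t\<bar> \<le> e"
      using cont[OF e] by blast
    obtain B where B: "0 \<le> B"
      and dense: "\<And>y. y \<in> step_group \<Longrightarrow> B \<le> y \<Longrightarrow> \<exists>v. set v \<subseteq> A \<and> \<bar>X v - y\<bar> \<le> \<delta>"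
      using X_asymptotically_dense_in_step_group[OF \<delta>] by blast
    define R where "R = B + x_max + \<delta>"
    have R: "0 \<le> R" using B x_max_pos \<delta> by (simp add: R_def)
    then have "[] \<in> words R" by (simp add: words_def)
    then have ne: "words R \<noteq> {}" by auto
    define c0 where "c0 = Min (W ` words R)"
    have "c0 \<in> W ` words R" unfolding c0_def using finite_words ne by (intro Min_in) auto
    then have c0: "0 < c0" using W_pos by (auto simp: words_def)
    have c0_le: "c0 \<le> W v" if "v \<in> words R" for v
      unfolding c0_def using that finite_words by auto
    \<comment> \<open>every word that is used below has probability at least \<open>c0\<close>, so an excess of \<open>2 * \<eta>\<close> at \<open>s\<close>
      permits a defect of at most \<open>2 * \<eta> / c0 = e\<close> at \<open>s - X v\<close>\<close>
    define \<eta> where "\<eta> = c0 * e / 2"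
    have \<eta>: "0 < \<eta>" using c0 e by (simp add: \<eta>_def)
    obtain T1 where T1: "\<And>t. t \<in> step_group \<Longrightarrow> T1 \<le> t \<Longrightarrow> Z t \<le> M + \<eta>" using upper[OF \<eta>] by blast
    define T2 where "T2 = max T T1 + x_max"
    obtain s where s: "s \<in> step_group" "T2 + R + x_max \<le> s" "M - \<eta> < Z s"
      using frequently[OF \<eta>] by blast
    define D where "D t = M + \<eta> - Z t" for t
    have D: "D t = (\<Sum>i\<in>A. w i * D (t - x i))" if "t \<in> step_group" "T2 \<le> t" for t
    proof -
      have "Z t = (\<Sum>i\<in>A. w i * Z (t - x i))"
        using that x_max_pos by (intro eq) (auto simp: T2_def)
      then show ?thesis
        by (simp add: D_def right_diff_distrib sum_subtractf w_sum flip: sum_distrib_right)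
    qed
    have D0: "0 \<le> D t" if "t \<in> step_group" "T2 - x_max \<le> t" for t
      using T1[of t] that by (simp add: D_def T2_def)
    have window: "M - 2 * e \<le> Z t" if t: "t \<in> step_group" "s - B - x_max \<le> t" "t \<le> s - B" for t
    proof -
      obtain v where v: "set v \<subseteq> A" "\<bar>X v - (s - t)\<bar> \<le> \<delta>"
        using dense[OF step_group_diff[OF s(1) t(1)]] t by auto
      have vR: "v \<in> words R" using v t by (auto simp: words_def R_def)
      have sv: "s - X v \<in> step_group" by (rule step_group_diff[OF s(1) X_in_step_group[OF v(1)]])
      have "T2 \<le> s - X v" using vR s(2) x_max_pos by (auto simp: words_def)
      then have "W v * D (s - X v) \<le> D s"
        using harmonic_word_le[of step_group T2 D v s, OF G D D0 v(1) s(1)] by blast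
      moreover have "c0 * D (s - X v) \<le> W v * D (s - X v)"
        using c0_le[OF vR] D0[OF sv] \<open>T2 \<le> s - X v\<close> x_max_pos by (intro mult_right_mono) auto
      moreover have "D s \<le> 2 * \<eta>" using s(3) by (simp add: D_def)
      ultimately have "c0 * D (s - X v) \<le> c0 * e" by (simp add: \<eta>_def)
      then have "D (s - X v) \<le> e" using c0 by simp
      moreover have "\<bar>Z (s - X v) - Z t\<bar> \<le> e"
        using v(2) by (intro Z\<delta>[OF sv t(1)]) (simp add: abs_minus_commute algebra_simps)
      ultimately show ?thesis using \<eta> by (simp add: D_def)
    qed
    have "M - 2 * e \<le> Z t" if "t \<in> step_group" "s - B \<le> t" for t
    proof (rule harmonic_ge[of step_group "s - B" Z])
      show "Z t = (\<Sum>i\<in>A. w i * Z (t - x i))" if "t \<in> step_group" "s - B \<le> t" for t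
        using that s(2) x_max_pos \<delta> by (intro eq) (auto simp: T2_def R_def)
    qed (use window G that x_max_pos in auto)
    then show ?thesis by blast
  qed
  show thesis
  proof (rule that[of M])
    fix e :: real assume e: "0 < e"
    obtain T1 where T1: "\<And>t. t \<in> step_group \<Longrightarrow> T1 \<le> t \<Longrightarrow> Z t \<le> M + e" using upper[OF e] by blast
    obtain T2 where T2: "\<And>t. t \<in> step_group \<Longrightarrow> T2 \<le> t \<Longrightarrow> M - 2 * (e / 2) \<le> Z t"
      using lower[of "e / 2"] e by auto
    show "\<exists>T. \<forall>t\<in>step_group. T \<le> t \<longrightarrow> \<bar>Z t - M\<bar> \<le> e"
    proof (intro exI[of _ "max T1 T2"] ballI impI)
      fix t assume "t \<in> step_group" "max T1 T2 \<le> t"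
      then show "\<bar>Z t - M\<bar> \<le> e" using T1[of t] T2[of t] by (simp add: abs_le_iff)
    qed
  qed
qed

end

section \<open>The renewal theorem for non-lattice steps\<close>

lemma uniformly_continuous_compact_support:
  fixes h :: "real \<Rightarrow> real"
  assumes cont: "continuous_on UNIV h" and h: "\<And>s. s \<le> a \<Longrightarrow> h s = 0" "\<And>s. b \<le> s \<Longrightarrow> h s = 0"
    and e: "0 < e"
  shows "\<exists>\<delta>>0. \<delta> \<le> 1 \<and> (\<forall>s t. \<bar>s - t\<bar> \<le> \<delta> \<longrightarrow> \<bar>h s - h t\<bar> \<le> e)"
proof -
  have "uniformly_continuous_on {a - 1..b + 1} h"
    using cont by (intro compact_uniformly_continuous) (auto intro: continuous_on_subset)
  then obtain d where d: "0 < d"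
    and hd: "\<And>s t. s \<in> {a - 1..b + 1} \<Longrightarrow> t \<in> {a - 1..b + 1} \<Longrightarrow> dist t s < d \<Longrightarrow> dist (h t) (h s) < e"
    using e unfolding uniformly_continuous_on_def by meson
  show ?thesis
  proof (intro exI[of _ "min 1 (d / 2)"] conjI allI impI)
    fix s t assume st: "\<bar>s - t\<bar> \<le> min 1 (d / 2)"
    consider "s \<in> {a - 1..b + 1}" "t \<in> {a - 1..b + 1}" | "s \<le> a" "t \<le> a" | "b \<le> s" "b \<le> t"
      using st by fastforce
    then show "\<bar>h s - h t\<bar> \<le> e"
    proof cases
      case 1
      then show ?thesis using hd[of t s] st d by (auto simp: dist_real_def)
    qed (use h e in auto)
  qed (use d in auto)
qed

text \<open>
  An antiderivative defined on the whole line lets the limit of the renewal sum be found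
  from a telescoping identity instead of from a double integral.
\<close>

lemma ex_antiderivative_compact_support:
  fixes h :: "real \<Rightarrow> real"
  assumes cont: "continuous_on UNIV h" and h: "\<And>s. s \<le> a \<Longrightarrow> h s = 0" "\<And>s. b \<le> s \<Longrightarrow> h s = 0"
    and ab: "a \<le> b"
  obtains H where "\<And>t. (H has_real_derivative h t) (at t)" "\<And>t. t \<le> a \<Longrightarrow> H t = 0"
    "\<And>t. b \<le> t \<Longrightarrow> H t = integral {a..b} h"
proof -
  define H where "H t = integral {a - 2..t} h" for t
  have int: "h integrable_on {r..s}" for r s
    using cont by (intro integrable_continuous_real) (auto intro: continuous_on_subset)
  have H0: "H t = 0" if "t \<le> a" for t
  proof -
    have "integral {a - 2..t} h = integral {a - 2..t} (\<lambda>_. 0)"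
      using h that by (intro integral_cong) auto
    then show ?thesis by (simp add: H_def)
  qed
  show thesis
  proof (rule that[of H])
    fix t
    show "(H has_real_derivative h t) (at t)"
    proof (cases "t < a")
      case True
      have "((\<lambda>_. 0) has_real_derivative h t) (at t)" using h(1)[of t] True by simp
      then show ?thesis
        by (rule has_field_derivative_transform_within_open[where S = "{..<a}"])
          (use True H0 in auto)
    next
      case False
      have "(H has_real_derivative h t) (at t within {a - 2..t + 1})"
        unfolding H_def using cont False
        by (intro integral_has_real_derivative) (auto intro: continuous_on_subset)
      then show ?thesis using False by (simp add: at_within_Icc_at)
    qed
  next
    fix t assume t: "b \<le> t"
    have "H t = integral {a - 2..a} h + (integral {a..b} h + integral {b..t} h)"
      unfolding H_def using ab t int
      by (simp add: Henstock_Kurzweil_Integration.integral_combine)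
    moreover have "integral {b..t} h = integral {b..t} (\<lambda>_. 0)"
      using h by (intro integral_cong) auto
    ultimately show "H t = integral {a..b} h" using H0[of a] by (simp add: H_def)
  qed (rule H0)
qed

context finite_renewal
begin

lemma step_group_dense:
  assumes small: "\<And>e. 0 < e \<Longrightarrow> \<exists>y\<in>step_group. 0 < y \<and> y < e" and e: "0 < e"
  shows "\<exists>g\<in>step_group. \<bar>g - t\<bar> < e"
proof -
  obtain y where y: "y \<in> step_group" "0 < y" "y < e" using small[OF e] by blast
  define k where "k = \<lfloor>t / y\<rfloor>"
  have "of_int k \<le> t / y" "t / y < of_int k + 1" unfolding k_def by linarith+
  then have "of_int k * y \<le> t" "t < of_int k * y + y" using y by (auto simp: field_simps)
  then show ?thesis
    using y step_group_mult_int[OF y(1), of k] by (intro bexI[of _ "of_int k * y"]) auto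
qed

lemma renewal_bounded:
  assumes h: "\<And>s. s < -1 \<Longrightarrow> h s = 0" "\<And>s. b \<le> s \<Longrightarrow> h s = 0"
  shows "\<exists>k::nat. \<forall>e t. (\<forall>s. \<bar>h s\<bar> \<le> e) \<longrightarrow> \<bar>renewal h t\<bar> \<le> real k * e"
proof -
  obtain k where k: "b + 1 < real k * x_min" using ex_less_of_nat_mult[OF x_min_pos] by blast
  show ?thesis
  proof (intro exI[of _ k] allI impI)
    fix e t assume "\<forall>s. \<bar>h s\<bar> \<le> e"
    then show "\<bar>renewal h t\<bar> \<le> real k * e" using h k by (intro abs_renewal_le) auto
  qed
qed

text \<open>
  The difference of two nearby values is the renewal sum of \<open>h (s - \<eta>) - h s\<close>, which is uniformly
  small and supported in a bounded set.
\<close>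

lemma renewal_uniformly_continuous:
  assumes cont: "continuous_on UNIV h"
    and h: "\<And>s. s \<le> -1 \<Longrightarrow> h s = 0" "\<And>s. b \<le> s \<Longrightarrow> h s = 0"
    and e: "0 < e"
  shows "\<exists>\<delta>>0. \<forall>s t. \<bar>s - t\<bar> \<le> \<delta> \<longrightarrow> \<bar>renewal h s - renewal h t\<bar> \<le> e"
proof -
  obtain k where k: "b + 2 < real k * x_min" using ex_less_of_nat_mult[OF x_min_pos] by blast
  define e' where "e' = e / (real k + 1)"
  have e': "0 < e'" using e by (simp add: e'_def)
  have ke: "real k * e' \<le> e" using e by (simp add: e'_def field_simps)
  obtain \<delta> where \<delta>: "0 < \<delta>" "\<delta> \<le> 1" and h\<delta>: "\<And>s t. \<bar>s - t\<bar> \<le> \<delta> \<Longrightarrow> \<bar>h s - h t\<bar> \<le> e'"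
    using uniformly_continuous_compact_support[OF cont h e'] by blast
  have *: "\<bar>renewal h (t - \<eta>) - renewal h t\<bar> \<le> e" if \<eta>: "0 \<le> \<eta>" "\<eta> \<le> \<delta>" for \<eta> t
  proof -
    have "renewal h (t - \<eta>) - renewal h t = renewal (\<lambda>s. h (s - \<eta>) - h s) t"
      using h \<eta> by (simp add: renewal_diff renewal_shift)
    moreover have "\<bar>renewal (\<lambda>s. h (s - \<eta>) - h s) t\<bar> \<le> real k * e'"
      using h \<eta> \<delta> k by (intro abs_renewal_le h\<delta>) auto
    ultimately show ?thesis using ke by simp
  qed
  show ?thesis
  proof (intro exI[of _ \<delta>] conjI allI impI)
    fix s t assume st: "\<bar>s - t\<bar> \<le> \<delta>"
    show "\<bar>renewal h s - renewal h t\<bar> \<le> e"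
      using *[of "t - s" t] *[of "s - t" s] st by (cases "s \<le> t") auto
  qed (rule \<delta>)
qed

lemma renewal_has_derivative:
  assumes H: "\<And>t. (H has_real_derivative h t) (at t)"
    and H0: "\<And>s. s < -1 \<Longrightarrow> H s = 0" and h0: "\<And>s. s < -1 \<Longrightarrow> h s = 0"
  shows "(renewal H has_real_derivative renewal h t) (at t)"
proof -
  have "((\<lambda>y. \<Sum>v\<in>words (t + 2). W v * H (y - X v)) has_real_derivative
      (\<Sum>v\<in>words (t + 2). W v * (h (t - X v) * 1))) (at t)"
    by (intro DERIV_sum DERIV_cmult DERIV_chain2[OF H])
      (auto intro!: derivative_eq_intros)
  moreover have "renewal h t = (\<Sum>v\<in>words (t + 2). W v * h (t - X v))"
    by (rule renewal_superset) (use h0 in auto)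
  ultimately have "((\<lambda>y. \<Sum>v\<in>words (t + 2). W v * H (y - X v)) has_real_derivative
      renewal h t) (at t)" by simp
  then show ?thesis
  proof (rule has_field_derivative_transform_within_open[where S = "{..<t + 1}"])
    fix y assume "y \<in> {..<t + 1}"
    then show "(\<Sum>v\<in>words (t + 2). W v * H (y - X v)) = renewal H y"
      using H0 by (intro renewal_superset[symmetric]) auto
  qed auto
qed

text \<open>
  The renewal sum satisfies the averaging equation beyond the support of \<open>h\<close>, so it converges along
  the dense group, and by uniform continuity along the whole line, to some \<open>c\<close>.  To find \<open>c\<close>, let
  \<open>H\<close> be the antiderivative of \<open>h\<close>.  The renewal sum \<open>I\<close> of \<open>H\<close> has derivative \<open>renewal h\<close>, so
  \<open>I t - I (t - y)\<close> tends to \<open>y * c\<close>; the renewal equation reads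
  \<open>(\<Sum>i\<in>A. w i * (I t - I (t - x i))) = H t\<close>, and comparing limits gives \<open>mean * c\<close> on the left and
  the integral of \<open>h\<close> on the right.
\<close>

theorem renewal_tendsto_continuous:
  assumes small: "\<And>e. 0 < e \<Longrightarrow> \<exists>y\<in>step_group. 0 < y \<and> y < e"
    and cont: "continuous_on UNIV h"
    and h: "\<And>s. s \<le> -1 \<Longrightarrow> h s = 0" "\<And>s. b \<le> s \<Longrightarrow> h s = 0" and b: "-1 \<le> b"
  shows "(renewal h \<longlongrightarrow> integral {-1..b} h / mean) at_top"
proof -
  have uc: "\<exists>\<delta>>0. \<forall>s t. \<bar>s - t\<bar> \<le> \<delta> \<longrightarrow> \<bar>renewal h s - renewal h t\<bar> \<le> e" if "0 < e" for e
    by (rule renewal_uniformly_continuous[OF cont h that])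
  have "bounded (h ` {-1..b})"
    using cont by (intro compact_imp_bounded compact_continuous_image)
      (auto intro: continuous_on_subset)
  then obtain C where C: "0 < C" "\<And>s. s \<in> {-1..b} \<Longrightarrow> \<bar>h s\<bar> \<le> C"
    by (auto simp: bounded_pos)
  have hC: "\<bar>h s\<bar> \<le> C" for s using C h[of s] by (cases "s \<in> {-1..b}") auto
  have h1: "h s = 0" if "s < -1" for s using h that by simp
  have "\<exists>k::nat. \<forall>e t. (\<forall>s. \<bar>h s\<bar> \<le> e) \<longrightarrow> \<bar>renewal h t\<bar> \<le> real k * e"
    by (rule renewal_bounded[of h b]) (use h1 h(2) in auto)
  then obtain k :: nat where bound: "\<And>t. \<bar>renewal h t\<bar> \<le> real k * C" using hC by blast
  have eqn: "renewal h t = h t + (\<Sum>i\<in>A. w i * renewal h (t - x i))" for t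
    by (rule renewal_eq) (rule h1)
  obtain c where c: "\<And>e. 0 < e \<Longrightarrow> \<exists>T. \<forall>t\<in>step_group. T \<le> t \<longrightarrow> \<bar>renewal h t - c\<bar> \<le> e"
  proof (rule harmonic_converges[of b "renewal h" "real k * C"])
    show "renewal h t = (\<Sum>i\<in>A. w i * renewal h (t - x i))" if "b \<le> t" for t
      using eqn[of t] h(2)[OF that] by linarith
    show "\<exists>\<delta>>0. \<forall>s\<in>step_group. \<forall>t\<in>step_group. \<bar>s - t\<bar> \<le> \<delta> \<longrightarrow> \<bar>renewal h s - renewal h t\<bar> \<le> e"
      if "0 < e" for e using uc[OF that] by blast
  qed (use bound in auto)
  have close: "\<exists>T. \<forall>t\<ge>T. \<bar>renewal h t - c\<bar> \<le> e" if e: "0 < e" for e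
  proof -
    obtain \<delta> where \<delta>: "0 < \<delta>"
      and uc\<delta>: "\<And>s t. \<bar>s - t\<bar> \<le> \<delta> \<Longrightarrow> \<bar>renewal h s - renewal h t\<bar> \<le> e / 2"
      using uc[of "e / 2"] e by auto
    obtain T where T: "\<And>t. t \<in> step_group \<Longrightarrow> T \<le> t \<Longrightarrow> \<bar>renewal h t - c\<bar> \<le> e / 2"
      using c[of "e / 2"] e by auto
    show ?thesis
    proof (intro exI[of _ "T + \<delta>"] allI impI)
      fix t assume t: "T + \<delta> \<le> t"
      obtain g where g: "g \<in> step_group" "\<bar>g - t\<bar> < \<delta>" using step_group_dense[OF small \<delta>] by blast
      then have "\<bar>renewal h g - c\<bar> \<le> e / 2" "\<bar>renewal h g - renewal h t\<bar> \<le> e / 2"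
        using T[OF g(1)] uc\<delta>[of g t] t by linarith+
      then show "\<bar>renewal h t - c\<bar> \<le> e" by linarith
    qed
  qed
  have lim: "(renewal h \<longlongrightarrow> c) at_top"
  proof (rule tendstoI)
    fix e :: real assume "0 < e"
    then obtain T where "\<forall>t\<ge>T. \<bar>renewal h t - c\<bar> \<le> e / 2" using close[of "e / 2"] by auto
    then show "\<forall>\<^sub>F t in at_top. dist (renewal h t) c < e"
      using \<open>0 < e\<close> by (intro eventually_at_top_linorderI[of T]) (force simp: dist_real_def)
  qed
  obtain H where H: "\<And>t. (H has_real_derivative h t) (at t)"
    and H0: "\<And>t. t \<le> -1 \<Longrightarrow> H t = 0" and HJ: "\<And>t. b \<le> t \<Longrightarrow> H t = integral {-1..b} h"
    using ex_antiderivative_compact_support[OF cont h b] by blast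
  have H_eqn: "renewal H t = H t + (\<Sum>i\<in>A. w i * renewal H (t - x i))" for t
    by (rule renewal_eq) (use H0 in auto)
  have deriv: "(renewal H has_real_derivative renewal h t) (at t)" for t
    by (rule renewal_has_derivative[OF H]) (use H0 h in auto)
  have incr: "((\<lambda>t. renewal H t - renewal H (t - y)) \<longlongrightarrow> y * c) at_top" if y: "0 < y" for y
  proof (rule tendstoI)
    fix e :: real assume e: "0 < e"
    then obtain T where T: "\<And>t. T \<le> t \<Longrightarrow> \<bar>renewal h t - c\<bar> \<le> e / (2 * y)"
      using close[of "e / (2 * y)"] y by auto
    have "dist (renewal H t - renewal H (t - y)) (y * c) < e" if t: "T + y \<le> t" for t
    proof -
      obtain \<xi> where \<xi>: "t - y < \<xi>" "renewal H t - renewal H (t - y) = (t - (t - y)) * renewal h \<xi>"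
        using MVT2[of "t - y" t "renewal H" "renewal h"] deriv y by auto
      have "\<bar>renewal h \<xi> - c\<bar> \<le> e / (2 * y)" using \<xi> t by (intro T) simp
      then have "y * \<bar>renewal h \<xi> - c\<bar> \<le> y * (e / (2 * y))" using y by (intro mult_left_mono) auto
      also have "\<dots> = e / 2" using y by simp
      finally have "\<bar>y * (renewal h \<xi> - c)\<bar> \<le> e / 2" using y by (simp add: abs_mult)
      then show ?thesis using \<xi>(2) e by (simp add: dist_real_def right_diff_distrib)
    qed
    then show "\<forall>\<^sub>F t in at_top. dist (renewal H t - renewal H (t - y)) (y * c) < e"
      by (intro eventually_at_top_linorderI[of "T + y"]) auto
  qed
  have "((\<lambda>t. \<Sum>i\<in>A. w i * (renewal H t - renewal H (t - x i))) \<longlongrightarrow> (\<Sum>i\<in>A. w i * (x i * c))) at_top"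
    by (intro tendsto_intros incr x_pos)
  moreover have "(\<Sum>i\<in>A. w i * (renewal H t - renewal H (t - x i))) = H t" for t
    using H_eqn[of t] by (simp add: right_diff_distrib sum_subtractf w_sum flip: sum_distrib_right)
  ultimately have "(H \<longlongrightarrow> mean * c) at_top" by (simp add: mean_def sum_distrib_left mult_ac)
  moreover have "(H \<longlongrightarrow> integral {-1..b} h) at_top"
    by (rule tendsto_eventually) (use HJ in \<open>auto intro: eventually_at_top_linorderI[of b]\<close>)
  ultimately have "mean * c = integral {-1..b} h"
    by (rule tendsto_unique[OF trivial_limit_at_top_linorder])
  then have "c = integral {-1..b} h / mean" using mean_pos by (simp add: field_simps)
  then show ?thesis using lim by simp
qed

end

context finite_renewal
begin

text \<open>
  A kernel that jumps at \<open>0\<close> and at \<open>y\<close>, with arbitrary values between \<open>0\<close> and \<open>\<phi>\<close> at the jumps, is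
  squeezed between \<open>\<phi>\<close> times two trapezoid functions of slope \<open>1 / \<delta>\<close>, whose integrals differ by
  \<open>O(\<delta>)\<close>.  The case \<open>y = 0\<close> says that single points do not contribute to the limit.
\<close>

theorem renewal_tendsto_interval:
  assumes small: "\<And>e. 0 < e \<Longrightarrow> \<exists>y\<in>step_group. 0 < y \<and> y < e"
    and cont: "continuous_on UNIV \<phi>" and pos: "\<And>s. 0 \<le> \<phi> s" and y: "0 \<le> y"
    and h: "\<And>s. 0 \<le> h s" "\<And>s. h s \<le> \<phi> s"
    and h_eq: "\<And>s. 0 < s \<Longrightarrow> s < y \<Longrightarrow> h s = \<phi> s"
    and h_0: "\<And>s. s < 0 \<Longrightarrow> h s = 0" "\<And>s. y < s \<Longrightarrow> h s = 0"
  shows "(renewal h \<longlongrightarrow> integral {0..y} \<phi> / mean) at_top"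
proof (rule tendstoI)
  fix e :: real assume e: "0 < e"
  define J where "J = integral {0..y} \<phi>"
  have "bounded (\<phi> ` {-1..y + 1})"
    using cont by (intro compact_imp_bounded compact_continuous_image)
      (auto intro: continuous_on_subset)
  then obtain C where C: "0 < C" "\<And>s. s \<in> {-1..y + 1} \<Longrightarrow> \<phi> s \<le> C"
    by (force simp: bounded_pos abs_le_iff)
  \<comment> \<open>\<open>\<delta> \<le> 1\<close> keeps the majorant supported in \<open>[-1, y + 1]\<close>; the two integrals differ by at most
    \<open>4 * \<delta> * C \<le> e * mean / 2\<close>\<close>
  define \<delta> where "\<delta> = min 1 (e * mean / (8 * C))"
  have \<delta>: "0 < \<delta>" "\<delta> \<le> 1" using e C mean_pos by (auto simp: \<delta>_def)
  have "\<delta> \<le> e * mean / (8 * C)" by (simp add: \<delta>_def)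
  then have \<delta>C: "4 * \<delta> * C / mean \<le> e / 2" using C mean_pos by (simp add: field_simps)
  define f where "f s = \<phi> s * max 0 (min 1 (min (s / \<delta>) ((y - s) / \<delta>)))" for s
  define g where "g s = \<phi> s * max 0 (min 1 (min (s / \<delta> + 1) ((y - s) / \<delta> + 1)))" for s
  define i where "i s = (if s \<in> {0..y} then \<phi> s else 0)" for s
  have cf: "continuous_on UNIV f" and cg: "continuous_on UNIV g"
    unfolding f_def g_def using cont \<delta>(1) by (auto intro!: continuous_intros)
  have f_le_\<phi>: "f s \<le> \<phi> s" for s
    unfolding f_def using pos[of s] by (intro mult_left_le) auto
  have f_0: "f s = 0" if "s \<le> 0 \<or> y \<le> s" for s
  proof -
    have "min (s / \<delta>) ((y - s) / \<delta>) \<le> 0"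
      using that \<delta> by (auto simp: min_le_iff_disj divide_le_0_iff)
    then have "min 1 (min (s / \<delta>) ((y - s) / \<delta>)) \<le> 0" by (rule min.coboundedI2)
    then show ?thesis by (simp only: f_def max_absorb1 mult_zero_right)
  qed
  have f_1: "f s = \<phi> s" if "\<delta> \<le> s" "s \<le> y - \<delta>" for s
    using that \<delta> by (simp add: f_def min_def max_def)
  have g_le_\<phi>: "g s \<le> \<phi> s" and g_nonneg: "0 \<le> g s" for s
    unfolding g_def using pos[of s] by (auto intro!: mult_left_le)
  have g_1: "g s = \<phi> s" if "0 \<le> s" "s \<le> y" for s
  proof -
    have "0 \<le> s / \<delta>" "0 \<le> (y - s) / \<delta>" using that \<delta> by auto
    then show ?thesis by (simp add: g_def min_def max_def)
  qed
  have g_0: "g s = 0" if "s \<le> - \<delta> \<or> y + \<delta> \<le> s" for s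
  proof -
    have "s / \<delta> + 1 \<le> 0 \<or> (y - s) / \<delta> + 1 \<le> 0" using that \<delta> by (auto simp: field_simps)
    then have "min (s / \<delta> + 1) ((y - s) / \<delta> + 1) \<le> 0" by auto
    then have "min 1 (min (s / \<delta> + 1) ((y - s) / \<delta> + 1)) \<le> 0" by (rule min.coboundedI2)
    then show ?thesis by (simp only: g_def max_absorb1 mult_zero_right)
  qed
  have f_le_h: "f s \<le> h s" for s
    using f_0[of s] h(1)[of s] h_eq[of s] f_le_\<phi>[of s] by (cases "0 < s \<and> s < y") auto
  have h_le_g: "h s \<le> g s" for s
    using g_1[of s] g_nonneg[of s] h_0[of s] h(2)[of s] by (cases "0 \<le> s \<and> s \<le> y") auto
  have int: "k integrable_on {-1..y + 1}" if "continuous_on UNIV k" for k :: "real \<Rightarrow> real"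
    using that by (intro integrable_continuous_real) (auto intro: continuous_on_subset)
  have "(\<phi> has_integral J) {0..y}"
    unfolding J_def using cont
    by (intro integrable_integral integrable_continuous_real) (auto intro: continuous_on_subset)
  then have i: "(i has_integral J) {-1..y + 1}"
    unfolding i_def by (subst has_integral_restrict) auto
  have fJ: "integral {-1..y + 1} f \<le> J"
    by (rule has_integral_le[OF integrable_integral[OF int[OF cf]] i])
      (use f_0 f_le_\<phi> in \<open>auto simp: i_def not_le intro: less_imp_le\<close>)
  have Jg: "J \<le> integral {-1..y + 1} g"
    by (rule has_integral_le[OF i integrable_integral[OF int[OF cg]]])
      (use g_1 g_nonneg in \<open>auto simp: i_def\<close>)
  \<comment> \<open>the two trapezoids agree outside the \<open>\<delta>\<close>-neighbourhoods of the jumps\<close>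
  define j where "j s = (if s \<in> {-\<delta>..\<delta>} then C else 0) + (if s \<in> {y - \<delta>..y + \<delta>} then C else 0)" for s
  have C1: "((\<lambda>s. if s \<in> {-\<delta>..\<delta>} then C else 0) has_integral 2 * \<delta> * C) {-1..y + 1}"
    using has_integral_const_real[of C "-\<delta>" \<delta>] \<delta> y by (subst has_integral_restrict) auto
  have C2: "((\<lambda>s. if s \<in> {y - \<delta>..y + \<delta>} then C else 0) has_integral 2 * \<delta> * C) {-1..y + 1}"
    using has_integral_const_real[of C "y - \<delta>" "y + \<delta>"] \<delta> y by (subst has_integral_restrict) auto
  have j: "(j has_integral 4 * \<delta> * C) {-1..y + 1}"
    unfolding j_def using has_integral_add[OF C1 C2] by (simp add: mult_ac)
  have "g s \<le> f s + j s" if s: "s \<in> {-1..y + 1}" for s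
  proof -
    have C': "g s \<le> C" using g_le_\<phi>[of s] C(2)[OF s] by linarith
    have f: "0 \<le> f s" unfolding f_def using pos[of s] by simp
    consider "s \<in> {-\<delta>..\<delta>}" | "s \<in> {y - \<delta>..y + \<delta>}" | "s < - \<delta> \<or> y + \<delta> < s" | "\<delta> < s" "s < y - \<delta>"
      by fastforce
    then show ?thesis
    proof cases
      case 3
      then show ?thesis using g_0[of s] f C by (auto simp: j_def)
    next
      case 4
      then show ?thesis using g_le_\<phi>[of s] f_1[of s] C by (auto simp: j_def)
    qed (use C' f C in \<open>auto simp: j_def\<close>)
  qed
  then have gf: "integral {-1..y + 1} g \<le> integral {-1..y + 1} f + 4 * \<delta> * C"
    by (intro has_integral_le[OF integrable_integral[OF int[OF cg]]
          has_integral_add[OF integrable_integral[OF int[OF cf]] j]])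
  have lim_f: "(renewal f \<longlongrightarrow> integral {-1..y + 1} f / mean) at_top"
    by (rule renewal_tendsto_continuous[OF small cf]) (use f_0 y in auto)
  have lim_g: "(renewal g \<longlongrightarrow> integral {-1..y + 1} g / mean) at_top"
    by (rule renewal_tendsto_continuous[OF small cg]) (use g_0 y \<delta> in auto)
  have "integral {-1..y + 1} g / mean \<le> (J + 4 * \<delta> * C) / mean"
    using gf fJ mean_pos by (intro divide_right_mono) auto
  then have "integral {-1..y + 1} g / mean < J / mean + e"
    using \<delta>C e by (simp add: add_divide_distrib)
  then have ev_g: "\<forall>\<^sub>F t in at_top. renewal g t < J / mean + e"
    by (rule order_tendstoD(2)[OF lim_g])
  have "(J - 4 * \<delta> * C) / mean \<le> integral {-1..y + 1} f / mean"
    using gf Jg mean_pos by (intro divide_right_mono) auto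
  then have "J / mean - e < integral {-1..y + 1} f / mean"
    using \<delta>C e by (simp add: diff_divide_distrib)
  then have ev_f: "\<forall>\<^sub>F t in at_top. J / mean - e < renewal f t"
    by (rule order_tendstoD(1)[OF lim_f])
  show "\<forall>\<^sub>F t in at_top. dist (renewal h t) (integral {0..y} \<phi> / mean) < e"
    using ev_f ev_g
  proof eventually_elim
    case (elim t)
    then show ?case
      using renewal_mono[of f h t, OF f_le_h] renewal_mono[of h g t, OF h_le_g]
      by (simp add: dist_real_def J_def abs_less_iff)
  qed
qed

section \<open>The renewal theorem for lattice steps\<close>

text \<open>
  On the lattice \<open>u\<int>\<close>, the renewal sum of the indicator \<open>a\<close> of \<open>0\<close> is the mass that the
  renewal measure gives to a lattice point.  It converges to some \<open>c\<close> by the convergence theorem,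
  where uniform continuity is trivial because distinct lattice points are at least \<open>u\<close> apart.  To find
  \<open>c\<close>, let \<open>I\<close> be the indicator of \<open>[0, \<infinity>)\<close>: the increment of its renewal sum over one lattice
  step is the renewal sum of \<open>a\<close>, and the renewal equation for \<open>I\<close> gives \<open>1 = (mean / u) * c\<close>.  For
  general \<open>h\<close> and \<open>t = n * u + f * u\<close>, only the values \<open>h (u * f + u * k)\<close> enter the renewal sum at
  \<open>t\<close>, each multiplied by the mass at the lattice point \<open>(n - k) * u\<close>.
\<close>

theorem renewal_lattice:
  assumes u: "0 < u" and G: "step_group = range (\<lambda>n::int. u * of_int n)"
    and C: "\<And>s. \<bar>h s\<bar> \<le> C" and h: "\<And>s. s < 0 \<Longrightarrow> h s = 0" "\<And>s. u * real (Suc K) \<le> s \<Longrightarrow> h s = 0"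
  shows "((\<lambda>t. renewal h t - u / mean * (\<Sum>k\<le>K. h (u * frac (t / u) + u * real k))) \<longlongrightarrow> 0) at_top"
proof -
  define a :: "real \<Rightarrow> real" where "a s = (if s = 0 then 1 else 0)" for s
  define I :: "real \<Rightarrow> real" where "I s = (if s < 0 then 0 else 1)" for s
  have uG: "u * of_int n \<in> step_group" for n :: int using G by auto
  have uN: "u * real n - u * real j \<in> step_group" for n j
    using uG[of "int n - int j"] by (simp add: algebra_simps)
  have a_eqn: "renewal a t = a t + (\<Sum>i\<in>A. w i * renewal a (t - x i))" for t
    by (rule renewal_eq) (auto simp: a_def)
  have "\<exists>k::nat. \<forall>e t. (\<forall>s. \<bar>a s\<bar> \<le> e) \<longrightarrow> \<bar>renewal a t\<bar> \<le> real k * e"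
    by (rule renewal_bounded[of a 1]) (auto simp: a_def)
  then obtain k :: nat where "(\<forall>s. \<bar>a s\<bar> \<le> 1) \<longrightarrow> \<bar>renewal a t\<bar> \<le> real k * 1" for t by blast
  then have bound: "\<bar>renewal a t\<bar> \<le> real k" for t by (simp add: a_def)
  obtain c where c: "\<And>e. 0 < e \<Longrightarrow> \<exists>T. \<forall>t\<in>step_group. T \<le> t \<longrightarrow> \<bar>renewal a t - c\<bar> \<le> e"
  proof (rule harmonic_converges[of 1 "renewal a" "real k"])
    show "renewal a t = (\<Sum>i\<in>A. w i * renewal a (t - x i))" if "1 \<le> t" for t
      using a_eqn[of t] that by (simp add: a_def)
    show "\<exists>\<delta>>0. \<forall>s\<in>step_group. \<forall>t\<in>step_group. \<bar>s - t\<bar> \<le> \<delta> \<longrightarrow> \<bar>renewal a s - renewal a t\<bar> \<le> e"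
      if "0 < e" for e
    proof (intro exI[of _ "u / 2"] conjI ballI impI)
      fix s t assume st: "s \<in> step_group" "t \<in> step_group" "\<bar>s - t\<bar> \<le> u / 2"
      then obtain m n :: int where mn: "s = u * of_int m" "t = u * of_int n" using G by auto
      have "u * \<bar>of_int (m - n)\<bar> \<le> u / 2"
        using st(3) u by (simp add: mn abs_mult flip: right_diff_distrib)
      then have "u * \<bar>of_int (m - n)\<bar> \<le> u * (1 / 2)" by simp
      then have "\<bar>of_int (m - n)\<bar> \<le> (1 / 2 :: real)" using u by (simp only: mult_le_cancel_left_pos)
      then have "m = n" by linarith
      then show "\<bar>renewal a s - renewal a t\<bar> \<le> e" using mn that by simp
    qed (use u in simp)
  qed (use bound in auto)
  have lim_a: "(\<lambda>n. renewal a (u * real n - u * real j)) \<longlonglongrightarrow> c" for j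
  proof (rule tendstoI)
    fix e :: real assume e: "0 < e"
    then obtain T where T: "\<And>t. t \<in> step_group \<Longrightarrow> T \<le> t \<Longrightarrow> \<bar>renewal a t - c\<bar> \<le> e / 2"
      using c[of "e / 2"] by auto
    obtain n0 where n0: "T + u * real j < real n0 * u" using ex_less_of_nat_mult[OF u] by blast
    have "T \<le> u * real n - u * real j" if "n0 \<le> n" for n
    proof -
      have "real n0 * u \<le> real n * u" using that u by (intro mult_right_mono) auto
      then show ?thesis using n0 mult.commute[of u "real n"] by linarith
    qed
    then have "dist (renewal a (u * real n - u * real j)) c < e" if "n0 \<le> n" for n
      using T[OF uN[of n j]] that e by (force simp: dist_real_def)
    then show "\<forall>\<^sub>F n in sequentially. dist (renewal a (u * real n - u * real j)) c < e"
      by (intro eventually_sequentiallyI[of n0])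
  qed
  have I_step: "renewal I t - renewal I (t - u) = renewal a t" if t: "t \<in> step_group" for t
  proof -
    have "renewal (\<lambda>s. I (s - u)) t = renewal I (t - u)"
      using u by (intro renewal_shift) (auto simp: I_def)
    then have "renewal I t - renewal I (t - u) = renewal (\<lambda>s. I s - I (s - u)) t"
      by (simp add: renewal_diff)
    also have "\<dots> = renewal a t"
      unfolding renewal_def
    proof (intro sum.cong refl arg_cong2[of _ _ _ _ "(*)"])
      fix v assume "v \<in> words (t + 1)"
      then have "t - X v \<in> step_group"
        using step_group_diff[OF t X_in_step_group] by (auto simp: words_def)
      then obtain n :: int where n: "t - X v = u * of_int n" using G by auto
      have "n < 0 \<or> n = 0 \<or> 1 \<le> n" by linarith
      then show "I (t - X v) - I (t - X v - u) = a (t - X v)"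
        unfolding n
      proof (elim disjE)
        assume "1 \<le> n"
        then have "u * 1 \<le> u * of_int n" using u by (intro mult_left_mono) auto
        then have "\<not> u * of_int n < 0" "\<not> u * of_int n - u < 0" "u * of_int n \<noteq> 0"
          using u by linarith+
        then show "I (u * of_int n) - I (u * of_int n - u) = a (u * of_int n)"
          by (simp only: I_def a_def if_False diff_self)
      qed (use u in \<open>auto simp: I_def a_def mult_less_0_iff\<close>)
    qed
    finally show ?thesis .
  qed
  have I_steps: "renewal I (u * real n) - renewal I (u * real n - u * real k)
      = (\<Sum>j<k. renewal a (u * real n - u * real j))" for n k
  proof (induction k)
    case (Suc k)
    then show ?case using I_step[OF uN[of n k]] by (simp add: algebra_simps)
  qed simp
  have "\<exists>k. x i = u * real k" if i: "i \<in> A" for i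
  proof -
    obtain n :: int where n: "x i = u * of_int n" using x_in_step_group[OF i] G by auto
    then have "0 < n" using x_pos[OF i] u by (simp add: zero_less_mult_iff)
    then show ?thesis using n by (intro exI[of _ "nat n"]) simp
  qed
  then obtain k where k: "\<And>i. i \<in> A \<Longrightarrow> x i = u * real (k i)" by metis
  have I_eqn: "renewal I t = I t + (\<Sum>i\<in>A. w i * renewal I (t - x i))" for t
    by (rule renewal_eq) (auto simp: I_def)
  have "(\<Sum>i\<in>A. w i * (\<Sum>j<k i. renewal a (u * real n - u * real j))) = 1" for n
  proof -
    have "(\<Sum>i\<in>A. w i * (\<Sum>j<k i. renewal a (u * real n - u * real j)))
        = (\<Sum>i\<in>A. w i * (renewal I (u * real n) - renewal I (u * real n - x i)))"
      by (intro sum.cong refl) (simp add: k flip: I_steps)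
    also have "\<dots> = I (u * real n)"
      using I_eqn[of "u * real n"]
      by (simp add: right_diff_distrib sum_subtractf w_sum flip: sum_distrib_right)
    finally show ?thesis using u by (simp add: I_def mult_less_0_iff)
  qed
  moreover have "(\<lambda>n. \<Sum>i\<in>A. w i * (\<Sum>j<k i. renewal a (u * real n - u * real j)))
      \<longlonglongrightarrow> (\<Sum>i\<in>A. w i * (\<Sum>j<k i. c))"
    by (intro tendsto_intros lim_a)
  ultimately have "(\<Sum>i\<in>A. w i * (real (k i) * c)) = 1"
    by (simp add: LIMSEQ_const_iff)
  moreover have "mean * c = u * (\<Sum>i\<in>A. w i * (real (k i) * c))"
    unfolding mean_def sum_distrib_left sum_distrib_right
    by (intro sum.cong) (auto simp: k)
  ultimately have c_eq: "c = u / mean" using mean_pos by (simp add: field_simps)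
  have decomp: "renewal h t = (\<Sum>k\<le>K. h (u * frac (t / u) + u * real k)
      * renewal a (u * of_int \<lfloor>t / u\<rfloor> - u * real k))" for t
  proof -
    define n where "n = \<lfloor>t / u\<rfloor>"
    define f where "f = frac (t / u)"
    have f: "0 \<le> f" "f < 1" by (simp_all add: f_def frac_lt_1)
    have "t / u = of_int n + f" by (simp add: n_def f_def frac_def)
    then have t: "t = u * of_int n + u * f" using u by (simp add: field_simps)
    define H where "H s = (\<Sum>k\<le>K. h (u * f + u * real k) * a (s - u * real k))" for s
    have H: "h (u * f + s) = H s" if s: "s \<in> step_group" for s
    proof -
      obtain m :: int where m: "s = u * of_int m" using s G by auto
      have a_eq: "a (s - u * real k) = (if int k = m then 1 else 0)" for k
        using u by (auto simp: a_def m)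
      consider "m < 0" | "0 \<le> m" "m \<le> int K" | "int K < m" by linarith
      then show ?thesis
      proof cases
        case 1
        then have "of_int m \<le> (-1 :: real)" by linarith
        then have "u * (f + of_int m) < 0" using f u by (intro mult_pos_neg) auto
        then have "h (u * f + s) = 0" by (intro h(1)) (simp add: m algebra_simps)
        then show ?thesis using 1 by (simp add: H_def a_eq)
      next
        case 2
        then have "H s = (\<Sum>k\<le>K. if k = nat m then h (u * f + u * real k) else 0)"
          unfolding H_def by (intro sum.cong) (auto simp: a_eq)
        also have "\<dots> = h (u * f + s)" using 2 by (simp add: m nat_le_iff)
        finally show ?thesis by simp
      next
        case 3
        then have "real (Suc K) \<le> of_int m" by linarith
        then have "u * real (Suc K) \<le> u * (f + of_int m)" using f u by (intro mult_left_mono) auto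
        then have "h (u * f + s) = 0" by (intro h(2)) (simp add: m algebra_simps)
        then show ?thesis using 3 by (simp add: H_def a_eq)
      qed
    qed
    have "renewal h t = (\<Sum>v\<in>words (t + 1). W v * H (u * of_int n - X v))"
      unfolding renewal_def
    proof (intro sum.cong refl arg_cong2[of _ _ _ _ "(*)"])
      fix v assume "v \<in> words (t + 1)"
      then have "u * of_int n - X v \<in> step_group"
        using step_group_diff[OF uG X_in_step_group] by (auto simp: words_def)
      then show "h (t - X v) = H (u * of_int n - X v)"
        using H by (simp add: t algebra_simps flip: H)
    qed
    also have "\<dots> = renewal H (u * of_int n)"
    proof (rule renewal_superset[symmetric])
      fix s :: real assume s: "s < -1"
      have "s - u * real k \<noteq> 0" for k using s u mult_nonneg_nonneg[of u "real k"] by linarith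
      then show "H s = 0" by (simp add: H_def a_def)
    next
      show "u * of_int n + 1 \<le> t + 1" using f u by (simp add: t)
    qed
    also have "\<dots> = (\<Sum>k\<le>K. h (u * f + u * real k) * renewal (\<lambda>s. a (s - u * real k)) (u * of_int n))"
      unfolding H_def by (rule renewal_sum)
    also have "\<dots> = (\<Sum>k\<le>K. h (u * f + u * real k) * renewal a (u * of_int n - u * real k))"
      using u by (intro sum.cong refl arg_cong2[of _ _ _ _ "(*)"] renewal_shift) (auto simp: a_def)
    finally show ?thesis by (simp add: n_def f_def)
  qed
  show ?thesis
  proof (rule tendstoI)
    fix e :: real assume e: "0 < e"
    have C0: "0 \<le> C" using C[of 0] by linarith
    define e' where "e' = e / (2 * (real (Suc K) * (C + 1)))"
    have P: "real (Suc K) * (C + 1) \<noteq> 0" using C0 by simp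
    have e': "0 < e'" using e C0 by (simp add: e'_def add_nonneg_pos)
    obtain T where T: "\<And>t. t \<in> step_group \<Longrightarrow> T \<le> t \<Longrightarrow> \<bar>renewal a t - c\<bar> \<le> e'" using c[OF e'] by auto
    have "dist (renewal h t - u / mean * (\<Sum>k\<le>K. h (u * frac (t / u) + u * real k))) 0 < e"
      if t: "T + u * real K + u \<le> t" for t
    proof -
      define n where "n = \<lfloor>t / u\<rfloor>"
      have "t / u < of_int n + 1" unfolding n_def by linarith
      then have n: "t < u * of_int n + u" using u by (simp add: field_simps)
      have summand: "\<bar>h s * (renewal a (u * of_int n - u * real k) - c)\<bar> \<le> (C + 1) * e'" if "k \<le> K" for k s
      proof -
        have "u * real k \<le> u * real K" using that u by (intro mult_left_mono) auto
        then have "T \<le> u * of_int n - u * real k" using n t by linarith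
        then have "\<bar>renewal a (u * of_int n - u * real k) - c\<bar> \<le> e'"
          using uG[of "n - int k"] by (intro T) (auto simp: algebra_simps)
        then show ?thesis
          unfolding abs_mult using C[of s] e' by (intro mult_mono) auto
      qed
      have "renewal h t - u / mean * (\<Sum>k\<le>K. h (u * frac (t / u) + u * real k))
          = (\<Sum>k\<le>K. h (u * frac (t / u) + u * real k) * (renewal a (u * of_int n - u * real k) - c))"
        unfolding decomp n_def c_eq by (simp add: right_diff_distrib sum_subtractf sum_distrib_left mult_ac)
      also have "\<bar>\<dots>\<bar> \<le> (\<Sum>k\<le>K. (C + 1) * e')"
        by (intro order_trans[OF sum_abs] sum_mono summand) auto
      also have "\<dots> = (real (Suc K) * (C + 1)) * e'" by simp
      also have "\<dots> = e / 2" using P by (simp add: e'_def del: of_nat_Suc)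
      finally show ?thesis using e by (simp add: dist_real_def)
    qed
    then show "\<forall>\<^sub>F t in at_top.
        dist (renewal h t - u / mean * (\<Sum>k\<le>K. h (u * frac (t / u) + u * real k))) 0 < e"
      by (intro eventually_at_top_linorderI)
  qed
qed

end

context finite_renewal
begin

section \<open>Averages of renewal sums\<close>

text \<open>
  Since \<open>mean * (J / mean) = J\<close>, the function \<open>t \<mapsto> (J / mean) * t\<close> solves the renewal equation of \<open>H\<close>
  on \<open>[L, \<infinity>)\<close>.  The difference \<open>E\<close> to it is equal to its averages there and hence bounded by the
  minimum principle, applied to \<open>E\<close> and \<open>- E\<close>.
\<close>

theorem renewal_linear_growth:
  assumes H: "\<And>s. s < -1 \<Longrightarrow> H s = 0" and C: "\<And>s. \<bar>H s\<bar> \<le> C" and J: "\<And>s. L \<le> s \<Longrightarrow> H s = J"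
  shows "((\<lambda>t. renewal H t / t) \<longlongrightarrow> J / mean) at_top"
proof -
  define c where "c = J / mean"
  define E where "E t = renewal H t - c * t" for t
  define M where "M = (\<Sum>v\<in>words (L + 1). W v * C) + \<bar>c\<bar> * (\<bar>L\<bar> + x_max)"
  have eqn: "renewal H t = H t + (\<Sum>i\<in>A. w i * renewal H (t - x i))" for t
    by (rule renewal_eq) (rule H)
  have E_eq: "E t = (\<Sum>i\<in>A. w i * E (t - x i))" if "L \<le> t" for t
  proof -
    have "(\<Sum>i\<in>A. w i * E (t - x i))
        = (\<Sum>i\<in>A. w i * renewal H (t - x i) - w i * (c * t) + w i * x i * c)"
      by (intro sum.cong) (simp_all add: E_def algebra_simps)
    also have "\<dots> = (\<Sum>i\<in>A. w i * renewal H (t - x i)) - c * t + mean * c"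
      by (simp only: sum.distrib sum_subtractf w_sum mean_def mult_1 flip: sum_distrib_right)
    also have "mean * c = J" using mean_pos by (simp add: c_def)
    also have "(\<Sum>i\<in>A. w i * renewal H (t - x i)) - c * t + J = E t"
      using eqn[of t] J[OF that] by (simp add: E_def)
    finally show ?thesis by simp
  qed
  have E_base: "\<bar>E t\<bar> \<le> M" if t: "L - x_max \<le> t" "t \<le> L" for t
  proof -
    have "renewal H t = (\<Sum>v\<in>words (L + 1). W v * H (t - X v))"
      by (rule renewal_superset) (use H t in auto)
    also have "\<bar>\<dots>\<bar> \<le> (\<Sum>v\<in>words (L + 1). W v * C)"
    proof (intro order_trans[OF sum_abs] sum_mono)
      fix v assume "v \<in> words (L + 1)"
      then have "0 < W v" by (intro W_pos) (auto simp: words_def)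
      then show "\<bar>W v * H (t - X v)\<bar> \<le> W v * C" using C by (simp add: abs_mult)
    qed
    finally have "\<bar>renewal H t\<bar> \<le> (\<Sum>v\<in>words (L + 1). W v * C)" .
    moreover have "\<bar>c * t\<bar> \<le> \<bar>c\<bar> * (\<bar>L\<bar> + x_max)"
      unfolding abs_mult using t x_max_pos by (intro mult_left_mono) auto
    ultimately show ?thesis unfolding E_def M_def by linarith
  qed
  have E_bound: "\<bar>E t\<bar> \<le> M" if "L \<le> t" for t
  proof -
    have t: "L - x_max \<le> t" using that x_max_pos by simp
    have base: "- M \<le> E s" "- M \<le> - E s" if "L - x_max \<le> s" "s \<le> L" for s
      using E_base[OF that] by linarith+
    have "- M \<le> E t"
      by (rule harmonic_ge[of UNIV L E]) (use E_eq base t in auto)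
    moreover have "- M \<le> - E t"
      by (rule harmonic_ge[of UNIV L "\<lambda>t. - E t"]) (use E_eq base t in \<open>auto simp: sum_negf\<close>)
    ultimately show ?thesis by (simp add: abs_le_iff)
  qed
  have "((\<lambda>t. E t / t) \<longlongrightarrow> 0) at_top"
  proof (rule Lim_null_comparison)
    show "((\<lambda>t::real. M / t) \<longlongrightarrow> 0) at_top"
      by (intro real_tendsto_divide_at_top[OF tendsto_const] filterlim_ident)
    show "\<forall>\<^sub>F t in at_top. norm (E t / t) \<le> M / t"
      using E_bound by (intro eventually_at_top_linorderI[of "max L 1"]) (auto intro!: divide_right_mono)
  qed
  then have "((\<lambda>t. c + E t / t) \<longlongrightarrow> c + 0) at_top"
    by (intro tendsto_add tendsto_const)
  then have "((\<lambda>t. c + E t / t) \<longlongrightarrow> c) at_top" by simp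
  then show ?thesis
    unfolding c_def[symmetric]
  proof (rule Lim_transform_eventually)
    show "\<forall>\<^sub>F t in at_top. c + E t / t = renewal H t / t"
      by (intro eventually_at_top_linorderI[of 1]) (simp add: E_def diff_divide_distrib)
  qed
qed

lemma integral_renewal:
  assumes h: "integrable lborel h" "\<And>s. s < 0 \<Longrightarrow> h s = 0" and T: "0 \<le> T"
  shows "set_integrable lborel {0..T} (renewal h)"
    and "(LBINT t:{0..T}. renewal h t) = renewal (\<lambda>s. LBINT y:{..s}. h y) T"
proof -
  define H where "H s = (LBINT y:{..s}. h y)" for s
  have int: "integrable lborel (\<lambda>s. indicator {..s'} s *\<^sub>R h s)" for s' :: real
    using h(1) by (intro integrable_mult_indicator) auto
  have shift: "integrable lborel (\<lambda>t. indicator {..T} t *\<^sub>R h (t - y))"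
    "(LBINT t. indicator {..T} t *\<^sub>R h (t - y)) = H (T - y)" for y
  proof -
    have *: "indicator {..T} t = (indicator {..T - y} (- y + 1 * t) :: real)" for t
      by (auto split: split_indicator)
    show "integrable lborel (\<lambda>t. indicator {..T} t *\<^sub>R h (t - y))"
      using lborel_integrable_real_affine[OF int, of 1 "T - y" "- y"] unfolding * by simp
    show "(LBINT t. indicator {..T} t *\<^sub>R h (t - y)) = H (T - y)"
      using lborel_integral_real_affine[of 1 "\<lambda>s. indicator {..T - y} s *\<^sub>R h s" "- y"]
      unfolding * by (simp add: H_def set_lebesgue_integral_def)
  qed
  have eq: "indicator {0..T} t *\<^sub>R renewal h t
      = (\<Sum>v\<in>words (T + 1). W v * (indicator {..T} t *\<^sub>R h (t - X v)))" for t
  proof (cases "0 \<le> t \<and> t \<le> T")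
    case True
    then show ?thesis using renewal_superset[of h t "T + 1"] h(2) by simp
  next
    case False
    have zero: "indicator {..T} t *\<^sub>R h (t - X v) = 0" if "v \<in> words (T + 1)" for v
    proof (cases "t < 0")
      case True
      then show ?thesis using X_nonneg[of v] that h(2)[of "t - X v"] by (simp add: words_def)
    qed (use False in auto)
    then have "(\<Sum>v\<in>words (T + 1). W v * (indicator {..T} t *\<^sub>R h (t - X v))) = 0"
      by (intro sum.neutral ballI) (simp only: zero mult_zero_right)
    then show ?thesis using False by simp
  qed
  show "set_integrable lborel {0..T} (renewal h)"
    unfolding set_integrable_def eq by (intro Bochner_Integration.integrable_sum integrable_mult_right shift)
  have "(LBINT t:{0..T}. renewal h t) = (\<Sum>v\<in>words (T + 1). W v * H (T - X v))"
  proof -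
    have "(LBINT t:{0..T}. renewal h t)
        = (\<Sum>v\<in>words (T + 1). LBINT t. W v * (indicator {..T} t *\<^sub>R h (t - X v)))"
      unfolding set_lebesgue_integral_def eq
      by (rule Bochner_Integration.integral_sum) (intro integrable_mult_right shift)
    then show ?thesis by (simp only: integral_mult_right_zero shift(2))
  qed
  then show "(LBINT t:{0..T}. renewal h t) = renewal (\<lambda>s. LBINT y:{..s}. h y) T"
    by (simp add: renewal_def H_def)
qed

text \<open>
  The integral of a renewal sum over \<open>[0, T]\<close> is the renewal sum of the primitive of \<open>h\<close>, whose
  linear growth is known.  This holds for lattice and non-lattice steps alike.
\<close>

theorem renewal_average:
  assumes h: "integrable lborel h" "\<And>s. s < 0 \<Longrightarrow> h s = 0" "\<And>s. L \<le> s \<Longrightarrow> h s = 0"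
  shows "((\<lambda>T. (LBINT t:{0..T}. renewal h t) / T) \<longlongrightarrow> (LBINT s. h s) / mean) at_top"
proof -
  define H where "H s = (LBINT y:{..s}. h y)" for s
  have "((\<lambda>T. renewal H T / T) \<longlongrightarrow> (LBINT s. h s) / mean) at_top"
  proof (rule renewal_linear_growth)
    fix s
    show "H s = 0" if "s < -1"
    proof -
      have "(\<lambda>y. indicator {..s} y *\<^sub>R h y) = (\<lambda>_. 0)"
        using h(2) that by (auto split: split_indicator)
      then show ?thesis by (simp add: H_def set_lebesgue_integral_def del: real_scaleR_def)
    qed
    have "\<bar>H s\<bar> \<le> (LBINT y. \<bar>indicator {..s} y *\<^sub>R h y\<bar>)"
      unfolding H_def set_lebesgue_integral_def by (rule integral_abs_bound)
    also have "\<dots> \<le> (LBINT y. \<bar>h y\<bar>)"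
      using h(1) by (intro integral_mono integrable_abs integrable_mult_indicator)
        (auto split: split_indicator)
    finally show "\<bar>H s\<bar> \<le> (LBINT y. \<bar>h y\<bar>)" .
    show "H s = (LBINT s. h s)" if "L \<le> s"
    proof -
      have "(\<lambda>y. indicator {..s} y *\<^sub>R h y) = h"
        using h(3) that by (auto split: split_indicator)
      then show ?thesis by (simp add: H_def set_lebesgue_integral_def del: real_scaleR_def)
    qed
  qed
  then show ?thesis
  proof (rule Lim_transform_eventually)
    show "\<forall>\<^sub>F T in at_top. renewal H T / T = (LBINT t:{0..T}. renewal h t) / T"
      using integral_renewal(2)[OF h(1,2)] by (intro eventually_at_top_linorderI[of 0]) (simp add: H_def[abs_def])
  qed
qed

end

text \<open>
  The substitution \<open>s = exp (- t)\<close>.  It reverses orientation, so it is split into the monotone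
  substitution by \<open>ln\<close> and a reflection.
\<close>

lemma integral_minus_ln_substitution:
  fixes Z :: "real \<Rightarrow> real"
  assumes r: "0 < r" "r < 1" and Z: "set_integrable lborel {0..- ln r} Z"
  shows "set_integrable lborel {r..1} (\<lambda>s. Z (- ln s) / s)"
    and "(LBINT s:{r..1}. Z (- ln s) / s) = (LBINT t:{0..- ln r}. Z t)"
proof -
  have ind: "indicator {0..- ln r} (- y) = (indicator {ln r..0} y :: real)" for y
    by (auto split: split_indicator)
  have int: "set_integrable lborel {ln r..ln 1} (\<lambda>y. Z (- y))"
    using lborel_integrable_real_affine[OF Z[unfolded set_integrable_def], of "-1" 0]
    by (simp add: set_integrable_def ind)
  have deriv: "(ln has_real_derivative 1 / s) (at s)" if "s \<in> {r..1}" for s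
    using that r by (auto intro!: derivative_eq_intros)
  have cont: "continuous_on {r..1} (\<lambda>s. 1 / s)"
    using r by (intro continuous_intros) auto
  have sub: "set_integrable lborel {r..1} (\<lambda>s. Z (- ln s) * (1 / s))"
    "(LBINT y. Z (- y) * indicator {ln r..ln 1} y) = (LBINT s. Z (- ln s) * (1 / s) * indicator {r..1} s)"
    using integral_substitution[where f = "\<lambda>y. Z (- y)" and g = ln and g' = "\<lambda>s. 1 / s" and a = r and b = 1,
        OF int deriv cont] r by auto
  show "set_integrable lborel {r..1} (\<lambda>s. Z (- ln s) / s)" using sub(1) by simp
  have "(LBINT t:{0..- ln r}. Z t) = (LBINT y. Z (- y) * indicator {ln r..ln 1} y)"
    using lborel_integral_real_affine[of "-1" "\<lambda>t. indicator {0..- ln r} t *\<^sub>R Z t" 0]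
    by (simp add: set_lebesgue_integral_def ind mult.commute)
  then show "(LBINT s:{r..1}. Z (- ln s) / s) = (LBINT t:{0..- ln r}. Z t)"
    using sub(2) by (simp add: set_lebesgue_integral_def mult.commute)
qed

context finite_renewal
begin

lemma step_group_eq_group_closure: "step_group = group_closure (x ` A)"
proof
  have X: "X v \<in> group_closure (x ` A)" if "set v \<subseteq> A" for v
    using that
  proof (induction v)
    case (Cons i v)
    then have "x i \<in> group_closure (x ` A)" by (intro group_closure.base) auto
    then show ?case using Cons by (auto intro: group_closure_add)
  qed simp
  show "step_group \<subseteq> group_closure (x ` A)"
    by (auto simp: step_group_def intro!: group_closure.diff X)
  show "group_closure (x ` A) \<subseteq> step_group"
  proof
    fix y assume "y \<in> group_closure (x ` A)"
    then show "y \<in> step_group"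
      by induction (auto simp: zero_in_step_group x_in_step_group step_group_diff)
  qed
qed

text \<open>
  A point of the group that is not isolated has other group elements arbitrarily close to it.
\<close>

lemma step_group_small_elements:
  assumes "\<not> discrete step_group" and e: "0 < e"
  shows "\<exists>y\<in>step_group. 0 < y \<and> y < e"
proof -
  obtain g where g: "g \<in> step_group" "\<not> g isolated_in step_group"
    using assms(1) by (auto simp: discrete_def)
  then obtain z where z: "z \<in> step_group" "dist g z < e" "z \<noteq> g"
    unfolding isolated_in_dist_Ex_iff using e by blast
  have "\<bar>g - z\<bar> \<in> step_group"
    using step_group_diff[OF g(1) z(1)] step_group_diff[OF z(1) g(1)] by (simp add: abs_if)
  then show ?thesis using z by (intro bexI[of _ "\<bar>g - z\<bar>"]) (auto simp: dist_real_def)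
qed

end

section \<open>The building blocks of the volume kernel\<close>

definition exp_piece :: "real \<Rightarrow> real \<Rightarrow> real \<Rightarrow> real" where
  "exp_piece a y s = (if 0 < s \<and> s < y then exp (- a * s) else 0)"

definition point_mass :: "real \<Rightarrow> real" where
  "point_mass s = (if s = 0 then 1 else 0)"

lemma has_derivative_exp_primitive:
  "a \<noteq> 0 \<Longrightarrow> ((\<lambda>s. - exp (- a * s) / a) has_real_derivative exp (- a * s)) (at s)" for a :: real
  by (auto intro!: derivative_eq_intros)

lemma exp_piece_integral:
  assumes a: "a \<noteq> 0" and y: "0 \<le> y"
  shows "has_bochner_integral lborel (exp_piece a y) ((1 - exp (- a * y)) / a)"
proof -
  have I: "has_bochner_integral lborel (\<lambda>s. exp (- a * s) * indicator {0..y} s)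
      (- exp (- a * y) / a - - exp (- a * 0) / a)"
    using y a by (intro has_bochner_integral_FTC_Icc_real has_derivative_exp_primitive) auto
  have ae: "AE s in lborel. exp (- a * s) * indicator {0..y} s = exp_piece a y s"
    using AE_lborel_singleton[of 0] AE_lborel_singleton[of y]
    by eventually_elim (auto simp: exp_piece_def split: split_indicator)
  have "has_bochner_integral lborel (exp_piece a y) (- exp (- a * y) / a - - exp (- a * 0) / a)"
  proof (subst has_bochner_integral_cong_AE[OF _ _ ae, symmetric])
    show "exp_piece a y \<in> borel_measurable lborel"
      unfolding exp_piece_def by measurable
  qed (use I in auto)
  moreover have "- exp (- a * y) / a - - exp (- a * 0) / a = (1 - exp (- a * y)) / a"
    using a by (simp add: field_simps)
  ultimately show ?thesis by simp
qed

lemma point_mass_integral: "has_bochner_integral lborel point_mass 0"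
proof -
  have ae: "AE s in lborel. point_mass s = 0"
    using AE_lborel_singleton[of 0] by eventually_elim (simp add: point_mass_def)
  have m: "point_mass \<in> borel_measurable lborel" unfolding point_mass_def by measurable
  show ?thesis
    by (subst has_bochner_integral_cong_AE[OF m _ ae]) auto
qed

text \<open>
  The sum over a shifted lattice is a geometric series.  If the shift is zero, the left endpoint \<open>0\<close>
  is hit by the term \<open>j = 0\<close> and excluded, so that the series starts one term later.
\<close>

lemma exp_piece_lattice_sum:
  assumes u: "0 < u" and a: "a \<noteq> 0" and f: "0 \<le> f" "f < 1" and k: "1 \<le> k" "k \<le> Suc K"
  shows "(\<Sum>j\<le>K. exp_piece a (u * real k) (u * f + u * real j))
    = (if f = 0 then exp (- u * a) - exp (- a * (u * real k)) else exp (- u * a * f) * (1 - exp (- a * (u * real k))))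
      / (1 - exp (- u * a))"
proof -
  define E where "E = exp (- u * a)"
  have E: "E \<noteq> 1" using u a by (simp add: E_def)
  have Ek: "exp (- a * (u * real k)) = E ^ k" by (simp add: E_def mult_ac flip: exp_of_nat_mult)
  have ev: "exp_piece a (u * real k) (u * f + u * real j)
      = (if (0 < f \<or> 0 < j) \<and> j < k then exp (- u * a * f) * E ^ j else 0)" for j
  proof -
    have "u * f + u * real j = u * (f + real j)" by (simp add: algebra_simps)
    moreover have "0 < u * (f + real j) \<longleftrightarrow> 0 < f \<or> 0 < j"
      using u f by (auto simp: zero_less_mult_iff)
    moreover have "u * (f + real j) < u * real k \<longleftrightarrow> j < k"
    proof -
      have "f + real j < real k \<longleftrightarrow> j < k" using f by linarith
      then show ?thesis using u by simp
    qed
    moreover have "exp (- a * (u * (f + real j))) = exp (- u * a * f) * E ^ j"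
      by (simp add: E_def algebra_simps flip: exp_of_nat_mult exp_add)
    ultimately show ?thesis by (simp add: exp_piece_def)
  qed
  have geo: "(\<Sum>j<k. E ^ j) = (1 - E ^ k) / (1 - E)" using E by (simp add: sum_gp_strict)
  show ?thesis
  proof (cases "f = 0")
    case True
    have "(\<Sum>j\<le>K. exp_piece a (u * real k) (u * f + u * real j)) = (\<Sum>j\<in>{..<k} - {0}. E ^ j)"
      unfolding ev using k True by (intro sum.mono_neutral_cong_right) auto
    also have "\<dots> = (\<Sum>j<k. E ^ j) - 1" using k by (subst sum_diff1) auto
    also have "\<dots> = (E - E ^ k) / (1 - E)" unfolding geo using E by (simp add: field_simps)
    finally show ?thesis using True unfolding Ek by (simp add: E_def)
  next
    case False
    have "(\<Sum>j\<le>K. exp_piece a (u * real k) (u * f + u * real j)) = (\<Sum>j<k. exp (- u * a * f) * E ^ j)"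
      unfolding ev using k False f by (intro sum.mono_neutral_cong_right) auto
    also have "\<dots> = exp (- u * a * f) * ((1 - E ^ k) / (1 - E))"
      by (simp add: geo flip: sum_distrib_left)
    finally show ?thesis using False unfolding Ek by (simp add: E_def)
  qed
qed

context finite_renewal
begin

lemma renewal_exp_piece_tendsto:
  assumes small: "\<And>e. 0 < e \<Longrightarrow> \<exists>y\<in>step_group. 0 < y \<and> y < e" and a: "a \<noteq> 0" and y: "0 \<le> y"
  shows "(renewal (exp_piece a y) \<longlongrightarrow> (1 - exp (- a * y)) / a / mean) at_top"
proof -
  have "((\<lambda>s. exp (- a * s)) has_integral (- exp (- a * y) / a - - exp (- a * 0) / a)) {0..y}"
    using y a by (intro fundamental_theorem_of_calculus)
      (auto simp flip: has_real_derivative_iff_has_vector_derivative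
        intro: DERIV_subset has_derivative_exp_primitive[simplified])
  then have "integral {0..y} (\<lambda>s. exp (- a * s)) = (1 - exp (- a * y)) / a"
    using a by (simp add: integral_unique field_simps)
  moreover have "(renewal (exp_piece a y) \<longlongrightarrow> integral {0..y} (\<lambda>s. exp (- a * s)) / mean) at_top"
    by (rule renewal_tendsto_interval[OF small])
      (use y in \<open>auto intro!: continuous_intros simp: exp_piece_def\<close>)
  ultimately show ?thesis by simp
qed

lemma renewal_point_mass_tendsto:
  assumes small: "\<And>e. 0 < e \<Longrightarrow> \<exists>y\<in>step_group. 0 < y \<and> y < e"
  shows "(renewal point_mass \<longlongrightarrow> 0) at_top"
proof -
  have "(renewal point_mass \<longlongrightarrow> integral {0..0} (\<lambda>_::real. 1) / mean) at_top"
    by (rule renewal_tendsto_interval[OF small]) (auto simp: point_mass_def)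
  then show ?thesis by simp
qed

end

section \<open>The symbolic volume as a renewal sum\<close>

text \<open>
  With \<open>t = - ln r\<close>, a letter \<open>i\<close> is a step of length \<open>- ln (\<rho> i)\<close> taken with probability
  \<open>p i powr q * \<rho> i powr \<beta>\<close>; the definition of \<open>\<beta>\<close> says exactly that these numbers sum to \<open>1\<close>.
\<close>

locale symbolic_volume =
  fixes d N :: nat and p \<rho> \<kappa> :: "nat \<Rightarrow> real" and q :: real
  assumes N: "1 \<le> N"
    and p: "\<And>i. i \<in> {1..N} \<Longrightarrow> 0 < p i"
    and \<rho>: "\<And>i. i \<in> {1..N} \<Longrightarrow> 0 < \<rho> i \<and> \<rho> i < 1"
    and nonresonant: "beta N p \<rho> q \<notin> (\<lambda>l. real l - real d * q) ` {0..d}"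
begin

\<comment> \<open>the letters are indexed by \<open>{1..N}\<close>, which would be rewritten to \<open>{Suc 0..N}\<close>\<close>
declare One_nat_def [simp del]

definition w :: "nat \<Rightarrow> real" where "w i = p i powr q * \<rho> i powr beta N p \<rho> q"

definition x :: "nat \<Rightarrow> real" where "x i = - ln (\<rho> i)"

definition a :: "nat \<Rightarrow> real" where "a l = beta N p \<rho> q - (real l - real d * q)"

lemma a_nonzero: "l \<in> {0..d} \<Longrightarrow> a l \<noteq> 0"
  using nonresonant by (auto simp: a_def)

sublocale finite_renewal "{1..N}" w x
proof
  have "(\<Sum>i=1..N. p i powr q * \<rho> i powr beta N p \<rho> q) = 1"
    unfolding beta_def by (rule theI') (rule beta_ex1[OF N p \<rho>])
  then show "sum w {1..N} = 1" by (simp add: w_def)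
  show "0 < w i" if "i \<in> {1..N}" for i using p[OF that] \<rho>[OF that] by (simp add: w_def)
  show "0 < x i" if "i \<in> {1..N}" for i using \<rho>[OF that] by (simp add: x_def)
qed simp

text \<open>
  The contribution of all children of a word \<open>v\<close> to \<open>C_sym\<close> with index \<open>l\<close>, normalised by
  \<open>r powr a l\<close>, is \<open>W v\<close> times this function at \<open>t - X v\<close>.  A child \<open>i\<close> counts fully while \<open>r\<close> lies
  strictly between the ratios of child and parent, that is for \<open>0 < t - X v < x i\<close>.  The point mass is
  the case of \<open>r\<close> equal to the parent's ratio, where all children count with the factor
  \<open>(1 + 1 / \<sigma>) / 2\<close> and their weights add up to \<open>\<sigma>\<close>.
\<close>

definition kernel :: "nat \<Rightarrow> real \<Rightarrow> real" where
  "kernel l s = (\<Sum>i=1..N. w i * exp (a l * x i) * exp_piece (a l) (x i) s)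
     + (sigma_ql d N p \<rho> q l + 1) / 2 * point_mass s"

definition h :: "real \<Rightarrow> real" where "h s = (\<Sum>l=0..d. \<kappa> l * kernel l s)"

definition J :: real where "J = (\<Sum>l=0..d. \<kappa> l * (sigma_ql d N p \<rho> q l - 1) / a l)"

lemma mean_eq: "mean = - (\<Sum>i=1..N. p i powr q * \<rho> i powr beta N p \<rho> q * ln (\<rho> i))"
  unfolding mean_def by (simp add: w_def x_def sum_negf)

lemma c_sym_eq: "c_sym d N p \<rho> \<kappa> q = J / mean"
  by (simp add: c_sym_def mean_eq J_def a_def[symmetric])

lemma weight_exp: "i \<in> {1..N} \<Longrightarrow> w i * exp (a l * x i) = p i powr q * \<rho> i powr (real l - real d * q)"
  using \<rho>[of i] by (simp add: w_def x_def a_def powr_def algebra_simps flip: exp_add)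

lemma sigma_eq: "sigma_ql d N p \<rho> q l = (\<Sum>i=1..N. w i * exp (a l * x i))"
  unfolding sigma_ql_def by (intro sum.cong refl weight_exp[symmetric])

lemma sigma_pos: "0 < sigma_ql d N p \<rho> q l"
  unfolding sigma_eq using N w_pos by (intro sum_pos) auto

lemma string_prod_pos: "set v \<subseteq> {1..N} \<Longrightarrow> 0 < string_prod \<rho> v" "set v \<subseteq> {1..N} \<Longrightarrow> 0 < string_prod p v"
  using p \<rho> by (induction v) (auto simp: string_prod_def)

lemma string_prod_append [simp]: "string_prod f (v @ [i]) = string_prod f v * f i" for f
  by (simp add: string_prod_def)

lemma X_eq: "set v \<subseteq> {1..N} \<Longrightarrow> X v = - ln (string_prod \<rho> v)"
proof (induction v)
  case (Cons i v)
  then show ?case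
    using \<rho>[of i] string_prod_pos(1)[of v] by (simp add: x_def[of i] string_prod_def ln_mult)
qed (simp add: string_prod_def)

lemma W_eq: "set v \<subseteq> {1..N} \<Longrightarrow> W v = string_prod p v powr q * string_prod \<rho> v powr beta N p \<rho> q"
proof (induction v)
  case (Cons i v)
  then show ?case
    using \<rho>[of i] p[of i] string_prod_pos[of v] by (simp add: w_def[of i] string_prod_def powr_mult)
qed (simp add: string_prod_def)

lemma kernel_0: "s < 0 \<Longrightarrow> kernel l s = 0" "x_max \<le> s \<Longrightarrow> kernel l s = 0"
proof -
  show "kernel l s = 0" if "s < 0"
    using that by (simp add: kernel_def exp_piece_def point_mass_def)
  assume s: "x_max \<le> s"
  then have "\<not> s < x i" if "i \<in> {1..N}" for i using x_max_ge[OF that] by simp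
  then show "kernel l s = 0"
    using s x_max_pos by (simp add: kernel_def exp_piece_def point_mass_def)
qed

lemma h_0: "s < 0 \<Longrightarrow> h s = 0" "x_max \<le> s \<Longrightarrow> h s = 0"
  by (simp_all add: h_def kernel_0)

lemma strings_eq:
  assumes r: "0 < r"
  shows "{v \<in> strings N. r \<le> string_prod \<rho> (butlast v)} = (\<lambda>(v, i). v @ [i]) ` (words (- ln r) \<times> {1..N})"
proof -
  have iff: "X v \<le> - ln r \<longleftrightarrow> r \<le> string_prod \<rho> v" if "set v \<subseteq> {1..N}" for v
    using string_prod_pos(1)[OF that] r X_eq[OF that] by simp
  show ?thesis
  proof (intro equalityI subsetI)
    fix v assume v: "v \<in> {v \<in> strings N. r \<le> string_prod \<rho> (butlast v)}"
    then have ne: "v \<noteq> []" and sub: "set v \<subseteq> {1..N}" by (auto simp: strings_def)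
    have "set (butlast v) \<subseteq> {1..N}" using sub by (auto dest: in_set_butlastD)
    then have "butlast v \<in> words (- ln r)" using v iff by (simp add: words_def)
    moreover have "last v \<in> {1..N}" using ne sub last_in_set by blast
    ultimately show "v \<in> (\<lambda>(v, i). v @ [i]) ` (words (- ln r) \<times> {1..N})"
      using ne by (intro image_eqI[of _ _ "(butlast v, last v)"]) auto
  next
    fix v assume "v \<in> (\<lambda>(v, i). v @ [i]) ` (words (- ln r) \<times> {1..N})"
    then show "v \<in> {v \<in> strings N. r \<le> string_prod \<rho> (butlast v)}"
      using iff by (auto simp: words_def strings_def)
  qed
qed

lemma sum_strings:
  assumes r: "0 < r" and P: "\<And>v. P v \<Longrightarrow> r \<le> string_prod \<rho> (butlast v)"
  shows "(\<Sum>v\<in>{v \<in> strings N. P v}. g v)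
    = (\<Sum>v\<in>words (- ln r). \<Sum>i=1..N. if P (v @ [i]) then g (v @ [i]) else 0)"
proof -
  let ?S = "{v \<in> strings N. r \<le> string_prod \<rho> (butlast v)}"
  have fin: "finite ?S" by (rule finite_strings_parent_ge[OF \<rho> r])
  have "(\<Sum>v\<in>{v \<in> strings N. P v}. g v) = (\<Sum>v\<in>?S. if P v then g v else 0)"
    using P fin by (intro sum.mono_neutral_cong_left) auto
  also have "\<dots> = (\<Sum>(v, i)\<in>words (- ln r) \<times> {1..N}. if P (v @ [i]) then g (v @ [i]) else 0)"
    unfolding strings_eq[OF r]
    by (subst sum.reindex) (auto intro!: inj_onI sum.cong simp: case_prod_unfold)
  finally show ?thesis by (simp add: sum.cartesian_product)
qed

text \<open>
  Every string is a word followed by a letter, so the sum over strings becomes a sum over their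
  parents \<open>v\<close> with the children gathered in the kernel.
\<close>

lemma C_sym_eq_renewal:
  assumes r: "0 < r"
  shows "C_sym d N p \<rho> q l r * r powr a l = renewal (kernel l) (- ln r)"
proof -
  define t where "t = - ln r"
  define g where "g v = string_prod p v powr q * string_prod \<rho> v powr (real l - real d * q)" for v
  have ra: "r powr a l = exp (- a l * t)" using r by (simp add: t_def powr_def)
  have g: "g (v @ [i]) * r powr a l = W v * (w i * exp (a l * x i) * exp (- a l * (t - X v)))"
    if v: "v \<in> words t" and i: "i \<in> {1..N}" for v i
  proof -
    have sub: "set v \<subseteq> {1..N}" using v by (simp add: words_def)
    have g1: "g (v @ [i]) = string_prod p v powr q * string_prod \<rho> v powr (real l - real d * q)
        * (p i powr q * \<rho> i powr (real l - real d * q))"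
      using p[OF i] \<rho>[OF i] string_prod_pos[OF sub] by (simp add: g_def powr_mult)
    have g2: "string_prod p v powr q * string_prod \<rho> v powr (real l - real d * q) = W v * exp (a l * X v)"
      using string_prod_pos(1)[OF sub]
      by (simp add: W_eq[OF sub] X_eq[OF sub] a_def powr_def algebra_simps flip: exp_add)
    have g3: "exp (- a l * (t - X v)) = exp (a l * X v) * exp (- a l * t)"
      by (simp add: algebra_simps flip: exp_add)
    show ?thesis unfolding g1 g2 weight_exp[OF i, symmetric] ra g3 by (simp only: mult_ac)
  qed
  have below: "string_prod \<rho> (v @ [i]) < r \<longleftrightarrow> t - X v < x i"
    and above: "r < string_prod \<rho> v \<longleftrightarrow> 0 < t - X v"
    and equal: "r = string_prod \<rho> v \<longleftrightarrow> t - X v = 0"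
    if v: "v \<in> words t" and i: "i \<in> {1..N}" for v i
  proof -
    have sub: "set v \<subseteq> {1..N}" using v by (simp add: words_def)
    have pos: "0 < string_prod \<rho> v" "0 < \<rho> i" using string_prod_pos(1)[OF sub] \<rho>[OF i] by auto
    have "string_prod \<rho> (v @ [i]) < r \<longleftrightarrow> ln (string_prod \<rho> v * \<rho> i) < ln r"
      using pos r by simp
    then show "string_prod \<rho> (v @ [i]) < r \<longleftrightarrow> t - X v < x i"
      using pos by (auto simp: ln_mult X_eq[OF sub] x_def t_def)
    show "r < string_prod \<rho> v \<longleftrightarrow> 0 < t - X v" "r = string_prod \<rho> v \<longleftrightarrow> t - X v = 0"
      using pos r by (auto simp: X_eq[OF sub] t_def)
  qed
  have 1: "(\<Sum>v\<in>{v \<in> strings N. string_prod \<rho> v < r \<and> r < string_prod \<rho> (butlast v)}. g v) * r powr a l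
      = (\<Sum>v\<in>words t. W v * (\<Sum>i=1..N. w i * exp (a l * x i) * exp_piece (a l) (x i) (t - X v)))"
    unfolding t_def
    by (subst sum_strings[OF r], simp, unfold sum_distrib_right sum_distrib_left t_def[symmetric],
        intro sum.cong refl) (auto simp: g below above exp_piece_def simp del: string_prod_append)
  have 2: "(\<Sum>v\<in>{v \<in> strings N. r = string_prod \<rho> (butlast v)}. g v) * r powr a l
      = (\<Sum>v\<in>words t. W v * (sigma_ql d N p \<rho> q l * point_mass (t - X v)))"
    unfolding t_def sigma_eq
    by (subst sum_strings[OF r], simp, unfold sum_distrib_right sum_distrib_left t_def[symmetric],
        intro sum.cong refl) (auto simp: g equal point_mass_def simp del: string_prod_append)
  define c where "c = (1 + 1 / sigma_ql d N p \<rho> q l) / 2"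
  have c: "c * (W v * (sigma_ql d N p \<rho> q l * y)) = W v * ((sigma_ql d N p \<rho> q l + 1) / 2 * y)" for v y
    using sigma_pos[of l] by (simp add: c_def field_simps)
  have "C_sym d N p \<rho> q l r * r powr a l
      = (\<Sum>v\<in>words t. W v * (\<Sum>i=1..N. w i * exp (a l * x i) * exp_piece (a l) (x i) (t - X v)))
        + c * (\<Sum>v\<in>words t. W v * (sigma_ql d N p \<rho> q l * point_mass (t - X v)))"
    unfolding 1[symmetric] 2[symmetric] C_sym_def g_def c_def by (simp only: distrib_right mult.assoc)
  also have "\<dots> = (\<Sum>v\<in>words t. W v * kernel l (t - X v))"
    unfolding sum_distrib_left[of c] c kernel_def distrib_left sum.distrib ..
  also have "\<dots> = (\<Sum>v\<in>words (t + 1). W v * kernel l (t - X v))"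
  proof (intro sum.mono_neutral_left ballI)
    fix v assume "v \<in> words (t + 1) - words t"
    then have "t - X v < 0" by (auto simp: words_def)
    then show "W v * kernel l (t - X v) = 0" by (simp add: kernel_0)
  qed (use finite_words in \<open>auto simp: words_def\<close>)
  finally show ?thesis by (simp add: renewal_def t_def)
qed

lemma V_sym_eq_renewal:
  assumes r: "0 < r"
  shows "1 / r powr (- beta N p \<rho> q) * V_sym d N p \<rho> \<kappa> q r = renewal h (- ln r)"
proof -
  have "1 / r powr (- beta N p \<rho> q) * V_sym d N p \<rho> \<kappa> q r
      = (\<Sum>l=0..d. \<kappa> l * (C_sym d N p \<rho> q l r * (r powr beta N p \<rho> q * r powr (- real l + real d * q))))"
    using r by (simp add: V_sym_def powr_minus sum_distrib_left mult_ac divide_simps)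
  also have "\<dots> = (\<Sum>l=0..d. \<kappa> l * (C_sym d N p \<rho> q l r * r powr a l))"
    by (simp add: a_def algebra_simps flip: powr_add)
  also have "\<dots> = renewal h (- ln r)"
    unfolding h_def renewal_sum by (simp add: C_sym_eq_renewal[OF r])
  finally show ?thesis .
qed

text \<open>
  The integral of \<open>exp (a * (x i - s))\<close> over \<open>[0, x i]\<close> is \<open>(exp (a * x i) - 1) / a\<close>; weighting by
  \<open>w i\<close> and summing gives \<open>(\<sigma> - 1) / a\<close>.
\<close>

lemma J_pieces:
  "J = (\<Sum>l=0..d. \<kappa> l * (\<Sum>i=1..N. w i * exp (a l * x i) * ((1 - exp (- a l * x i)) / a l)))"
proof -
  have "(\<Sum>i=1..N. w i * exp (a l * x i) * ((1 - exp (- a l * x i)) / a l))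
      = (sigma_ql d N p \<rho> q l - 1) / a l" for l
  proof -
    have "w i * exp (a l * x i) * (1 - exp (- a l * x i)) = w i * exp (a l * x i) - w i" for i
      by (simp add: algebra_simps flip: exp_add)
    then have "(\<Sum>i=1..N. w i * exp (a l * x i) * (1 - exp (- a l * x i))) = sigma_ql d N p \<rho> q l - 1"
      by (simp add: sum_subtractf sigma_eq w_sum)
    then show ?thesis by (simp flip: sum_divide_distrib)
  qed
  then show ?thesis by (simp add: J_def)
qed

lemma renewal_h:
  "renewal h t = (\<Sum>l=0..d. \<kappa> l * ((\<Sum>i=1..N. w i * exp (a l * x i) * renewal (exp_piece (a l) (x i)) t)
     + (sigma_ql d N p \<rho> q l + 1) / 2 * renewal point_mass t))"
  unfolding h_def renewal_sum kernel_def renewal_add renewal_cmult by simp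

lemma renewal_h_tendsto:
  assumes small: "\<And>e. 0 < e \<Longrightarrow> \<exists>y\<in>step_group. 0 < y \<and> y < e"
  shows "(renewal h \<longlongrightarrow> J / mean) at_top"
proof -
  have "(renewal h \<longlongrightarrow> (\<Sum>l=0..d. \<kappa> l * ((\<Sum>i=1..N. w i * exp (a l * x i)
      * ((1 - exp (- a l * x i)) / a l / mean)) + (sigma_ql d N p \<rho> q l + 1) / 2 * 0))) at_top"
    unfolding renewal_h[abs_def]
    by (intro tendsto_intros renewal_exp_piece_tendsto renewal_point_mass_tendsto small a_nonzero less_imp_le[OF x_pos])
  moreover have "(\<Sum>l=0..d. \<kappa> l * ((\<Sum>i=1..N. w i * exp (a l * x i)
      * ((1 - exp (- a l * x i)) / a l / mean)) + (sigma_ql d N p \<rho> q l + 1) / 2 * 0)) = J / mean"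
    by (simp only: J_pieces times_divide_eq_right mult_zero_right add_0_right sum_divide_distrib[symmetric])
  ultimately show ?thesis by simp
qed

lemma h_integral: "has_bochner_integral lborel h J"
proof -
  have "has_bochner_integral lborel h (\<Sum>l=0..d. \<kappa> l * ((\<Sum>i=1..N. w i * exp (a l * x i)
      * ((1 - exp (- a l * x i)) / a l)) + (sigma_ql d N p \<rho> q l + 1) / 2 * 0))"
    unfolding h_def kernel_def
    by (intro has_bochner_integral_sum has_bochner_integral_add has_bochner_integral_mult_right
        exp_piece_integral point_mass_integral a_nonzero less_imp_le[OF x_pos])
  then show ?thesis unfolding J_pieces by simp
qed

lemma h_bounded: "\<exists>C. \<forall>s. \<bar>h s\<bar> \<le> C"
proof -
  have piece: "\<bar>exp_piece b y s\<bar> \<le> exp (\<bar>b\<bar> * \<bar>y\<bar>)" for b y s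
  proof (cases "0 < s \<and> s < y")
    case True
    have "- b * s \<le> \<bar>- b * s\<bar>" by simp
    also have "\<dots> \<le> \<bar>b\<bar> * \<bar>y\<bar>" unfolding abs_mult using True by (intro mult_mono) auto
    finally show ?thesis using True by (simp add: exp_piece_def)
  qed (auto simp: exp_piece_def)
  have mass: "\<bar>point_mass s\<bar> \<le> 1" for s by (simp add: point_mass_def)
  have "\<bar>h s\<bar> \<le> (\<Sum>l=0..d. \<bar>\<kappa> l\<bar> * ((\<Sum>i=1..N. \<bar>w i * exp (a l * x i)\<bar> * exp (\<bar>a l\<bar> * \<bar>x i\<bar>))
      + \<bar>(sigma_ql d N p \<rho> q l + 1) / 2\<bar> * 1))" for s
    unfolding h_def kernel_def
    by (intro order_trans[OF sum_abs] sum_mono order_trans[OF eq_refl[OF abs_mult]] mult_left_mono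
        order_trans[OF abs_triangle_ineq] add_mono piece mass abs_ge_zero)
  then show ?thesis by blast
qed

text \<open>
  The sum of the kernel over a shifted lattice is evaluated by geometric series.  When \<open>r\<close> lies in
  \<open>exp (u\<int>)\<close>, the series from \<open>j = 1\<close> on gives \<open>(\<sigma> * E - 1) / (1 - E)\<close> with \<open>E = exp (- u * a)\<close>, and
  the point mass adds \<open>(\<sigma> + 1) / 2\<close>; together this is \<open>(\<sigma> - 1) / (1 - E) * (E + 1) / 2\<close>, the special
  value of \<open>\<theta>\<close> on this set.
\<close>

lemma lattice_profile:
  assumes u: "0 < u" and G: "step_group = range (\<lambda>n::int. u * of_int n)" and r: "0 < r"
    and K: "x_max \<le> u * real (Suc K)"
  shows "u / mean * (\<Sum>k\<le>K. h (u * frac (- ln r / u) + u * real k)) = pi_sym d N p \<rho> \<kappa> q u r"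
proof -
  define f where "f = frac (- ln r / u)"
  have f: "0 \<le> f" "f < 1" by (simp_all add: f_def frac_lt_1)
  have f_0: "f = 0 \<longleftrightarrow> r \<in> range (\<lambda>n::int. exp (of_int n * u))"
  proof
    assume "f = 0"
    then have "- ln r / u \<in> \<int>" by (simp only: f_def frac_eq_0_iff)
    then obtain n :: int where "- ln r / u = of_int n" by (elim Ints_cases)
    then have "ln r = of_int (- n) * u" using u by (simp add: field_simps)
    then have "r = exp (of_int (- n) * u)" using r by (metis exp_ln)
    then show "r \<in> range (\<lambda>n::int. exp (of_int n * u))" by blast
  next
    assume "r \<in> range (\<lambda>n::int. exp (of_int n * u))"
    then obtain n :: int where "r = exp (of_int n * u)" by blast
    then have "- ln r / u = of_int (- n)" using u by simp
    then show "f = 0" by (simp add: f_def frac_eq_0_iff)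
  qed
  have kernel_sum: "(\<Sum>j\<le>K. kernel l (u * f + u * real j))
      = (sigma_ql d N p \<rho> q l - 1) / (1 - exp (- u * a l)) * theta_sym u (a l) r"
    if l: "l \<in> {0..d}" for l
  proof -
    define E where "E = exp (- u * a l)"
    have E: "1 - E \<noteq> 0" using u a_nonzero[OF l] by (simp add: E_def)
    have piece: "w i * exp (a l * x i) * (\<Sum>j\<le>K. exp_piece (a l) (x i) (u * f + u * real j))
        = (if f = 0 then w i * exp (a l * x i) * E - w i else exp (- u * a l * f) * (w i * exp (a l * x i) - w i))
          / (1 - E)" if i: "i \<in> {1..N}" for i
    proof -
      obtain n :: int where n: "x i = u * of_int n" using x_in_step_group[OF i] G by auto
      have "0 < n" using x_pos[OF i] u by (simp add: n zero_less_mult_iff)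
      moreover have "of_int n \<le> real (Suc K)"
      proof -
        have "u * of_int n \<le> u * real (Suc K)" using x_max_ge[OF i] K n by linarith
        then show ?thesis using u by (simp only: mult_le_cancel_left_pos)
      qed
      ultimately have k: "1 \<le> nat n" "nat n \<le> Suc K" by linarith+
      have xi: "x i = u * real (nat n)" using n \<open>0 < n\<close> by simp
      have inv: "exp (a l * x i) * exp (- a l * x i) = 1" by (simp flip: exp_add)
      show ?thesis
        unfolding xi exp_piece_lattice_sum[OF u a_nonzero[OF l] f k] E_def[symmetric]
        using inv[unfolded xi] by (auto simp: algebra_simps)
    qed
    have mass: "(\<Sum>j\<le>K. point_mass (u * f + u * real j)) = (if f = 0 then 1 else 0)"
    proof -
      have "point_mass (u * f + u * real j) = (if j = 0 then if f = 0 then 1 else 0 else 0)" for j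
      proof -
        have "u * f + u * real j = u * (f + real j)" by (simp add: algebra_simps)
        then show ?thesis using u f by (auto simp: point_mass_def add_nonneg_eq_0_iff)
      qed
      then show ?thesis by simp
    qed
    have "(\<Sum>j\<le>K. kernel l (u * f + u * real j))
        = (\<Sum>i=1..N. w i * exp (a l * x i) * (\<Sum>j\<le>K. exp_piece (a l) (x i) (u * f + u * real j)))
          + (sigma_ql d N p \<rho> q l + 1) / 2 * (\<Sum>j\<le>K. point_mass (u * f + u * real j))"
      unfolding kernel_def sum.distrib sum_distrib_left by (subst sum.swap) simp
    also have "\<dots> = (if f = 0 then sigma_ql d N p \<rho> q l * E - 1
          else exp (- u * a l * f) * (sigma_ql d N p \<rho> q l - 1)) / (1 - E)
        + (sigma_ql d N p \<rho> q l + 1) / 2 * (if f = 0 then 1 else 0)"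
      by (simp add: piece mass sigma_eq w_sum sum_subtractf
          flip: sum_divide_distrib sum_distrib_right sum_distrib_left)
    also have "\<dots> = (sigma_ql d N p \<rho> q l - 1) / (1 - E) * theta_sym u (a l) r"
    proof (cases "f = 0")
      case True
      then have "theta_sym u (a l) r = (E + 1) / 2" using f_0 by (simp add: theta_sym_def E_def)
      then show ?thesis using True E by (simp add: field_simps)
    next
      case False
      then have "theta_sym u (a l) r = exp (- u * a l * f)" using f_0 by (simp add: theta_sym_def f_def)
      then show ?thesis using False by simp
    qed
    finally show ?thesis by (simp add: E_def)
  qed
  have "(\<Sum>k\<le>K. h (u * f + u * real k)) = (\<Sum>l=0..d. \<kappa> l * (\<Sum>k\<le>K. kernel l (u * f + u * real k)))"
    unfolding h_def sum_distrib_left by (rule sum.swap)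
  then show ?thesis
    unfolding f_def[symmetric]
    by (simp add: kernel_sum pi_sym_def mean_eq a_def[symmetric] mult.assoc)
qed

end

section \<open>Asymptotics of the symbolic volume\<close>

lemma filterlim_minus_ln_at_right_0: "filterlim (\<lambda>r::real. - ln r) at_top (at_right 0)"
  using ln_at_0 by (simp add: filterlim_uminus_at_bot)

lemma theta_sym_periodic:
  assumes u: "0 < u" and r: "0 < r"
  shows "theta_sym u a (exp u * r) = theta_sym u a r"
proof -
  have "exp u * r \<in> range (\<lambda>n::int. exp (of_int n * u)) \<longleftrightarrow> r \<in> range (\<lambda>n::int. exp (of_int n * u))"
  proof
    assume "exp u * r \<in> range (\<lambda>n::int. exp (of_int n * u))"
    then obtain n :: int where "exp u * r = exp (of_int n * u)" by blast
    then have "r = exp (of_int (n - 1) * u)" by (simp add: left_diff_distrib exp_diff field_simps)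
    then show "r \<in> range (\<lambda>n::int. exp (of_int n * u))" by blast
  next
    assume "r \<in> range (\<lambda>n::int. exp (of_int n * u))"
    then obtain n :: int where "r = exp (of_int n * u)" by blast
    then have "exp u * r = exp (of_int (n + 1) * u)" by (simp add: algebra_simps flip: exp_add)
    then show "exp u * r \<in> range (\<lambda>n::int. exp (of_int n * u))" by blast
  qed
  moreover have "frac (- (ln (exp u * r) / u)) = frac (- (ln r / u))"
  proof -
    have "- (ln (exp u * r) / u) = - (ln r / u) - 1"
      using u r by (simp add: ln_mult field_simps)
    moreover have "frac (y - 1) = frac y" for y :: real by (simp add: frac_def)
    ultimately show ?thesis by simp
  qed
  ultimately show ?thesis by (simp add: theta_sym_def)
qed

context symbolic_volume
begin

lemma step_group_eq: "step_group = group_closure ((\<lambda>i. ln (inverse (\<rho> i))) ` {1..N})"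
proof -
  have "x ` {1..N} = (\<lambda>i. ln (inverse (\<rho> i))) ` {1..N}"
    using \<rho> by (intro image_cong refl) (simp add: x_def ln_inverse)
  then show ?thesis by (simp add: step_group_eq_group_closure)
qed

lemma non_arithmetic_not_discrete:
  assumes "\<not> arithmetic N \<rho>"
  shows "\<not> discrete step_group"
proof
  assume "discrete step_group"
  then have "discrete_additive_subgroup step_group"
    by (simp add: discrete_additive_subgroup_def zero_in_step_group step_group_add step_group_uminus)
  moreover have "(\<lambda>i. ln (inverse (\<rho> i))) ` {1..N} \<subseteq> step_group"
    unfolding step_group_eq by (auto intro: group_closure.base)
  ultimately show False using assms unfolding arithmetic_def by blast
qed

lemma V_sym_tendsto:
  assumes "\<not> arithmetic N \<rho>"
  shows "((\<lambda>r. 1 / r powr (- beta N p \<rho> q) * V_sym d N p \<rho> \<kappa> q r) \<longlongrightarrow> c_sym d N p \<rho> \<kappa> q) (at_right 0)"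
proof -
  have "(renewal h \<longlongrightarrow> J / mean) at_top"
    by (intro renewal_h_tendsto step_group_small_elements non_arithmetic_not_discrete assms)
  then have "((\<lambda>r. renewal h (- ln r)) \<longlongrightarrow> c_sym d N p \<rho> \<kappa> q) (at_right 0)"
    unfolding c_sym_eq by (rule filterlim_compose) (rule filterlim_minus_ln_at_right_0)
  then show ?thesis
  proof (rule Lim_transform_eventually)
    show "\<forall>\<^sub>F r in at_right 0. renewal h (- ln r) = 1 / r powr (- beta N p \<rho> q) * V_sym d N p \<rho> \<kappa> q r"
      using V_sym_eq_renewal by (intro eventually_at_rightI[of 0 1]) auto
  qed
qed

lemma V_sym_minus_pi_sym_tendsto:
  assumes u: "0 < u" and G: "step_group = range (\<lambda>n::int. u * of_int n)"
  shows "((\<lambda>r. 1 / r powr (- beta N p \<rho> q) * V_sym d N p \<rho> \<kappa> q r - pi_sym d N p \<rho> \<kappa> q u r) \<longlongrightarrow> 0)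
    (at_right 0)"
proof -
  obtain C where C: "\<And>s. \<bar>h s\<bar> \<le> C" using h_bounded by blast
  obtain K where "x_max < real K * u" using ex_less_of_nat_mult[OF u] by blast
  then have K: "x_max \<le> u * real (Suc K)" using u by (simp add: algebra_simps)
  have "((\<lambda>t. renewal h t - u / mean * (\<Sum>k\<le>K. h (u * frac (t / u) + u * real k))) \<longlongrightarrow> 0) at_top"
    by (rule renewal_lattice[OF u G C]) (use K in \<open>auto intro: h_0\<close>)
  then have "((\<lambda>r. renewal h (- ln r)
      - u / mean * (\<Sum>k\<le>K. h (u * frac (- ln r / u) + u * real k))) \<longlongrightarrow> 0) (at_right 0)"
    by (rule filterlim_compose) (rule filterlim_minus_ln_at_right_0)
  then show ?thesis
  proof (rule Lim_transform_eventually)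
    show "\<forall>\<^sub>F r in at_right 0. renewal h (- ln r)
        - u / mean * (\<Sum>k\<le>K. h (u * frac (- ln r / u) + u * real k))
      = 1 / r powr (- beta N p \<rho> q) * V_sym d N p \<rho> \<kappa> q r - pi_sym d N p \<rho> \<kappa> q u r"
      using V_sym_eq_renewal lattice_profile[OF u G _ K] by (intro eventually_at_rightI[of 0 1]) auto
  qed
qed

lemma ave_integrand_eq:
  "0 < s \<Longrightarrow> ave_integrand d N p \<rho> \<kappa> q (beta N p \<rho> q) s = renewal h (- ln s) / s"
  unfolding ave_integrand_def V_sym_eq_renewal ..

lemma ave_integrand_integrable:
  assumes r: "0 < r" "r < 1"
  shows "set_integrable lborel {r..1} (ave_integrand d N p \<rho> \<kappa> q (beta N p \<rho> q))"
proof -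
  have "set_integrable lborel {0..- ln r} (renewal h)"
    using r h_integral by (intro integral_renewal h_0) (auto simp: has_bochner_integral_iff)
  then have "set_integrable lborel {r..1} (\<lambda>s. renewal h (- ln s) / s)"
    by (rule integral_minus_ln_substitution[OF r])
  then show ?thesis
    by (subst set_integrable_cong[OF refl refl]) (use r in \<open>auto simp: ave_integrand_eq\<close>)
qed

lemma ave_V_sym_tendsto:
  "(ave_V_sym d N p \<rho> \<kappa> q (beta N p \<rho> q) \<longlongrightarrow> c_sym d N p \<rho> \<kappa> q) (at_right 0)"
proof -
  have int: "integrable lborel h" "(LBINT s. h s) = J"
    using h_integral by (auto simp: has_bochner_integral_iff)
  have "((\<lambda>T. (LBINT t:{0..T}. renewal h t) / T) \<longlongrightarrow> (LBINT s. h s) / mean) at_top"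
    by (rule renewal_average[OF int(1)]) (auto intro: h_0)
  then have "((\<lambda>r. (LBINT t:{0..- ln r}. renewal h t) / (- ln r)) \<longlongrightarrow> c_sym d N p \<rho> \<kappa> q) (at_right 0)"
    unfolding c_sym_eq int(2) by (rule filterlim_compose) (rule filterlim_minus_ln_at_right_0)
  then show ?thesis
  proof (rule Lim_transform_eventually)
    have "(LBINT t:{0..- ln r}. renewal h t) / (- ln r) = ave_V_sym d N p \<rho> \<kappa> q (beta N p \<rho> q) r"
      if r: "0 < r" "r < 1" for r
    proof -
      have "(LBINT s:{r..1}. ave_integrand d N p \<rho> \<kappa> q (beta N p \<rho> q) s)
          = (LBINT s:{r..1}. renewal h (- ln s) / s)"
        using r by (intro set_lebesgue_integral_cong) (auto simp: ave_integrand_eq)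
      also have "\<dots> = (LBINT t:{0..- ln r}. renewal h t)"
        using r by (intro integral_minus_ln_substitution(2) integral_renewal(1) int h_0) auto
      finally show ?thesis by (simp add: ave_V_sym_def)
    qed
    then show "\<forall>\<^sub>F r in at_right 0. (LBINT t:{0..- ln r}. renewal h t) / (- ln r)
        = ave_V_sym d N p \<rho> \<kappa> q (beta N p \<rho> q) r"
      by (intro eventually_at_rightI[of 0 1]) auto
  qed
qed

end

theorem theorem5p7:
  fixes N :: nat
    and S :: "nat \<Rightarrow> real ^ 'd \<Rightarrow> real ^ 'd"
    and p \<rho> \<kappa> :: "nat \<Rightarrow> real"
    and K :: "(real ^ 'd) set"
    and \<mu> :: "(real ^ 'd) measure"
    and q :: real
  defines "d \<equiv> CARD('d)"
    and "b \<equiv> beta N p \<rho> q"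
    and "r_min \<equiv> Min (\<rho> ` {1..N})"
  assumes "2 \<le> N"
    and "\<And>i. i \<in> {1..N} \<Longrightarrow> contracting_similarity (\<rho> i) (S i)"
    and "\<And>i. i \<in> {1..N} \<Longrightarrow> 0 < p i"
    and "(\<Sum>i=1..N. p i) = 1"
    and "self_similar_set N S K"
    and "self_similar_measure N S p \<mu>"
    and "(\<Sum>l=0..d. \<kappa> l * (sigma_ql d N p \<rho> q l - 1)) = 0"
    and "b \<notin> (\<lambda>l. real l - real d * q) ` {0..d}"
  shows
    "(\<not> arithmetic N \<rho> \<longrightarrow>
        (\<exists>\<epsilon>. (\<forall>r. 0 < r \<and> r < r_min \<longrightarrow>
                 1 / r powr (- b) * V_sym d N p \<rho> \<kappa> q r = c_sym d N p \<rho> \<kappa> q + \<epsilon> r) \<and>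
             (\<epsilon> \<longlongrightarrow> 0) (at_right 0)) \<and>
        sym_Minkowski_measurable d N p \<rho> \<kappa> q b \<and>
        M_sym d N p \<rho> \<kappa> q b = c_sym d N p \<rho> \<kappa> q) \<and>
     (\<forall>u. arithmetic N \<rho> \<and> 0 < u \<and>
        group_closure ((\<lambda>i. ln (inverse (\<rho> i))) ` {1..N}) = range (\<lambda>n::int. u * of_int n) \<longrightarrow>
        (\<forall>r>0. pi_sym d N p \<rho> \<kappa> q u (exp u * r) = pi_sym d N p \<rho> \<kappa> q u r) \<and>
        (\<exists>\<epsilon>. (\<forall>r. 0 < r \<and> r < r_min \<longrightarrow>
                 1 / r powr (- b) * V_sym d N p \<rho> \<kappa> q r = pi_sym d N p \<rho> \<kappa> q u r + \<epsilon> r) \<and>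
             (\<epsilon> \<longlongrightarrow> 0) (at_right 0)) \<and>
        ave_sym_Minkowski_measurable d N p \<rho> \<kappa> q b \<and>
        M_ave_sym d N p \<rho> \<kappa> q b = c_sym d N p \<rho> \<kappa> q)"
proof -
  interpret symbolic_volume d N p \<rho> \<kappa> q
  proof
    show "0 < \<rho> i \<and> \<rho> i < 1" if "i \<in> {1..N}" for i
      using assms(5)[OF that] by (simp add: contracting_similarity_def)
  qed (use assms in auto)
  define V where "V r = 1 / r powr (- b) * V_sym d N p \<rho> \<kappa> q r" for r
  have nonarithmetic: "(\<exists>\<epsilon>. (\<forall>r. 0 < r \<and> r < r_min \<longrightarrow> V r = c_sym d N p \<rho> \<kappa> q + \<epsilon> r) \<and>
             (\<epsilon> \<longlongrightarrow> 0) (at_right 0)) \<and>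
        sym_Minkowski_measurable d N p \<rho> \<kappa> q b \<and> M_sym d N p \<rho> \<kappa> q b = c_sym d N p \<rho> \<kappa> q"
    if "\<not> arithmetic N \<rho>"
  proof -
    have lim: "(V \<longlongrightarrow> c_sym d N p \<rho> \<kappa> q) (at_right 0)"
      unfolding V_def b_def by (rule V_sym_tendsto[OF that])
    show ?thesis
    proof (intro conjI exI[of _ "\<lambda>r. V r - c_sym d N p \<rho> \<kappa> q"])
      show "((\<lambda>r. V r - c_sym d N p \<rho> \<kappa> q) \<longlongrightarrow> 0) (at_right 0)" using lim by (rule LIM_zero)
      show "sym_Minkowski_measurable d N p \<rho> \<kappa> q b"
        using lim unfolding sym_Minkowski_measurable_def V_def by blast
      show "M_sym d N p \<rho> \<kappa> q b = c_sym d N p \<rho> \<kappa> q"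
        using lim unfolding M_sym_def V_def by (rule tendsto_Lim[OF trivial_limit_at_right_real])
    qed simp
  qed
  have periodic: "pi_sym d N p \<rho> \<kappa> q u (exp u * r) = pi_sym d N p \<rho> \<kappa> q u r" if "0 < u" "0 < r" for u r
    unfolding pi_sym_def theta_sym_periodic[OF that] ..
  have expansion: "\<exists>\<epsilon>. (\<forall>r. 0 < r \<and> r < r_min \<longrightarrow> V r = pi_sym d N p \<rho> \<kappa> q u r + \<epsilon> r) \<and>
             (\<epsilon> \<longlongrightarrow> 0) (at_right 0)"
    if "0 < u" "group_closure ((\<lambda>i. ln (inverse (\<rho> i))) ` {1..N}) = range (\<lambda>n::int. u * of_int n)" for u
  proof (intro exI[of _ "\<lambda>r. V r - pi_sym d N p \<rho> \<kappa> q u r"] conjI)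
    show "((\<lambda>r. V r - pi_sym d N p \<rho> \<kappa> q u r) \<longlongrightarrow> 0) (at_right 0)"
      unfolding V_def b_def by (rule V_sym_minus_pi_sym_tendsto) (use that step_group_eq in auto)
  qed simp
  have average: "ave_sym_Minkowski_measurable d N p \<rho> \<kappa> q b" "M_ave_sym d N p \<rho> \<kappa> q b = c_sym d N p \<rho> \<kappa> q"
    using ave_V_sym_tendsto ave_integrand_integrable unfolding b_def
    by (auto simp: ave_sym_Minkowski_measurable_def M_ave_sym_def
        intro: tendsto_Lim[OF trivial_limit_at_right_real])
  show ?thesis
    using nonarithmetic periodic expansion average unfolding V_def by blast
qed

end
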